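(* Let $C(t)$ be a Legendre null curve in a 3-dimensional Sasaki-like almost contact B-metric manifold $(M,\varphi,\xi,\eta,g)$, with $b=g(\dot C,\varphi\dot C)$. Then $\nabla_{\dot C}\dot C$ and the curvature $k_1$ are given by $$\nabla_{\dot C}\dot C=b\,\xi+\frac{\dot b}{2b}\dot C,\qquad k_1=\epsilon b,\quad \epsilon=\pm1.$$
   Context: A 3-dimensional almost contact B-metric manifold $(M,\varphi,\xi,\eta,g)$ is a smooth 3-manifold with an endomorphism $\varphi$ of $TM$, a vector field $\xi$, a 1-form $\eta$ and a pseudo-Riemannian metric $g$ (necessarily of signature $(+,+,-)$) such that $\varphi^2X=-X+\eta(X)\xi$, $\eta(\xi)=1$, $g(\varphi X,\varphi Y)=-g(X,Y)+\eta(X)\eta(Y)$. Consequences: $\eta\circ\varphi=0$, $\varphi\xi=0$, $\eta(X)=g(X,\xi)$. With $\nabla$ the Levi-Civita connection of $g$, it is Sasaki-like if $(\nabla_X\varphi)Y=-g(X,Y)\xi-\eta(Y)X+2\eta(X)\eta(Y)\xi$ (then $\nabla_X\xi=-\varphi X$). A smooth curve $C:I\to M$ ($I$ an interval) is null if $g(\dot C,\dot C)=0$ and $\dot C\neq 0$ on $I$; it is Legendre if $\eta(\dot C)=0$. $\dot b=db/dt$; for a Legendre null curve $b$ is nowhere zero. A general Frenet frame along a null curve is $\{\dot C,N,W\}$ with $g(\dot C,N)=g(W,W)=1$, $g(N,N)=g(N,W)=g(\dot C,W)=0$; the curvature $k_1$ is defined by $\nabla_{\dot C}\dot C=h\dot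 C+k_1W$, and for a given parameter it depends on the frame only up to sign. *)

theory Defs
  imports "HOL-Analysis.Analysis" "HOL-Library.Function_Algebras"
begin

instantiation "fun" :: (type, real_vector) real_vector
begin

definition scaleR_fun :: "real \<Rightarrow> ('a \<Rightarrow> 'b) \<Rightarrow> 'a \<Rightarrow> 'b"
  where "scaleR_fun r f = (\<lambda>x. r *\<^sub>R f x)"

instance
  by standard (simp_all add: scaleR_fun_def plus_fun_def fun_eq_iff algebra_simps)

end


section \<open>Smooth functions\<close>

text \<open>\<open>C\<^sup>k\<close> maps; only used for open \<open>S\<close>.\<close>

primrec Ck_on :: "nat \<Rightarrow> 'e::real_normed_vector set \<Rightarrow> ('e \<Rightarrow> 'f::real_normed_vector) \<Rightarrow> bool"
  where
    "Ck_on 0 S f \<longleftrightarrow> continuous_on S f"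
  | "Ck_on (Suc k) S f \<longleftrightarrow>
       (\<forall>x\<in>S. f differentiable (at x)) \<and>
       (\<forall>v. Ck_on k S (\<lambda>x. frechet_derivative f (at x) v))"

definition smooth_on :: "'e::real_normed_vector set \<Rightarrow> ('e \<Rightarrow> 'f::real_normed_vector) \<Rightarrow> bool"
  where "smooth_on S f \<longleftrightarrow> (\<forall>k. Ck_on k S f)"

text \<open>Functions of one real parameter. The set \<open>S\<close> will be a relatively open subset of an
  interval, which may contain its end points; derivatives at such points are one-sided.
  The function \<open>F n\<close> is the \<open>n\<close>-th derivative.\<close>

definition smooth_on_real :: "real set \<Rightarrow> (real \<Rightarrow> 'f::real_normed_vector) \<Rightarrow> bool"
  where "smooth_on_real S f \<longleftrightarrow>
    (\<exists>F. (\<forall>t\<in>S. F 0 t = f t) \<and>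
         (\<forall>n. \<forall>t\<in>S. (F n has_vector_derivative F (Suc n) t) (at t within S)))"


section \<open>Smooth manifolds\<close>

text \<open>A chart is a pair of its domain and its coordinate map. The model space is \<open>'e\<close>.\<close>

type_synonym ('a, 'e) chart = "'a set \<times> ('a \<Rightarrow> 'e)"

definition chart_inv :: "('a, 'e) chart \<Rightarrow> 'e \<Rightarrow> 'a"
  where "chart_inv c = inv_into (fst c) (snd c)"

definition transition :: "('a, 'e) chart \<Rightarrow> ('a, 'e) chart \<Rightarrow> 'e \<Rightarrow> 'e"
  where "transition c d = snd d \<circ> chart_inv c"

definition smooth_manifold :: "'a topology \<Rightarrow> ('a, 'e::euclidean_space) chart set \<Rightarrow> bool"
  where "smooth_manifold M A \<longleftrightarrow>
    Hausdorff_space M \<and> second_countable M \<and>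
    \<Union>(fst ` A) = topspace M \<and>
    (\<forall>c\<in>A. openin M (fst c) \<and> open (snd c ` fst c) \<and>
      homeomorphic_map (subtopology M (fst c)) (top_of_set (snd c ` fst c)) (snd c)) \<and>
    (\<forall>c\<in>A. \<forall>d\<in>A. smooth_on (snd c ` (fst c \<inter> fst d)) (transition c d))"

definition charts_at :: "('a, 'e) chart set \<Rightarrow> 'a \<Rightarrow> ('a, 'e) chart set"
  where "charts_at A p = {c \<in> A. p \<in> fst c}"

definition smooth_function ::
  "('a, 'e::euclidean_space) chart set \<Rightarrow> 'a set \<Rightarrow> ('a \<Rightarrow> real) \<Rightarrow> bool"
  where "smooth_function A W f \<longleftrightarrow>
    (\<forall>c\<in>A. smooth_on (snd c ` (W \<inter> fst c)) (f \<circ> chart_inv c))"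


section \<open>Tangent vectors and vector fields\<close>

text \<open>A tangent vector at \<open>p\<close> is the family of its component vectors in the charts around \<open>p\<close>,
  related by the Jacobians of the transition maps. The family is set to \<open>0\<close> at all other charts,
  so that equality of tangent vectors is equality of families.\<close>

type_synonym ('a, 'e) tangent = "('a, 'e) chart \<Rightarrow> 'e"

definition tangent_space ::
  "('a, 'e::euclidean_space) chart set \<Rightarrow> 'a \<Rightarrow> ('a, 'e) tangent set"
  where "tangent_space A p = {v.
    (\<forall>c. c \<notin> charts_at A p \<longrightarrow> v c = 0) \<and>
    (\<forall>c\<in>charts_at A p. \<forall>d\<in>charts_at A p.
       v d = frechet_derivative (transition c d) (at (snd c p)) (v c))}"

text \<open>The field with constant components \<open>e\<close> in the chart \<open>c\<close>; for a basis vector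
  \<open>e\<close> this is the coordinate field \<open>\<partial>\<^sub>e\<close> of \<open>c\<close>.\<close>

definition coord_field ::
  "('a, 'e::euclidean_space) chart set \<Rightarrow> ('a, 'e) chart \<Rightarrow> 'e \<Rightarrow> 'a \<Rightarrow> ('a, 'e) tangent"
  where "coord_field A c e p =
    (\<lambda>d. if d \<in> charts_at A p then frechet_derivative (transition c d) (at (snd c p)) e else 0)"

text \<open>Smooth vector fields on an open set \<open>W\<close>.\<close>

definition vector_field ::
  "('a, 'e::euclidean_space) chart set \<Rightarrow> 'a set \<Rightarrow> ('a \<Rightarrow> ('a, 'e) tangent) \<Rightarrow> bool"
  where "vector_field A W X \<longleftrightarrow>
    (\<forall>p\<in>W. X p \<in> tangent_space A p) \<and>
    (\<forall>c\<in>A. smooth_on (snd c ` (W \<inter> fst c)) (\<lambda>x. X (chart_inv c x) c))"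

text \<open>The derivative \<open>v(f)\<close> of a function at \<open>p\<close>; it does not depend on the chart
  used to compute it.\<close>

definition tangent_deriv ::
  "('a, 'e::euclidean_space) chart set \<Rightarrow> 'a \<Rightarrow> ('a, 'e) tangent \<Rightarrow> ('a \<Rightarrow> real) \<Rightarrow> real"
  where "tangent_deriv A p v f =
    (let c = (SOME c. c \<in> charts_at A p)
     in frechet_derivative (f \<circ> chart_inv c) (at (snd c p)) (v c))"

definition lie_bracket ::
  "('a, 'e::euclidean_space) chart set \<Rightarrow> ('a \<Rightarrow> ('a, 'e) tangent) \<Rightarrow> ('a \<Rightarrow> ('a, 'e) tangent)
    \<Rightarrow> 'a \<Rightarrow> ('a, 'e) tangent"
  where "lie_bracket A X Y p =
    (\<lambda>c. if c \<in> charts_at A p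
         then frechet_derivative (\<lambda>x. Y (chart_inv c x) c) (at (snd c p)) (X p c)
            - frechet_derivative (\<lambda>x. X (chart_inv c x) c) (at (snd c p)) (Y p c)
         else 0)"


section \<open>Metrics and connections\<close>

definition linear_map_on ::
  "'v::real_vector set \<Rightarrow> ('v \<Rightarrow> 'w::real_vector) \<Rightarrow> bool"
  where "linear_map_on T f \<longleftrightarrow>
    (\<forall>v\<in>T. \<forall>w\<in>T. f (v + w) = f v + f w) \<and> (\<forall>r. \<forall>v\<in>T. f (r *\<^sub>R v) = r *\<^sub>R f v)"

text \<open>A smooth nondegenerate symmetric \<open>(0,2)\<close>-tensor field. That the signature is the
  same at all points is not required here: for the B-metrics considered below it is
  forced by the compatibility condition.\<close>

definition pseudo_riemannian_metric ::
  "'a topology \<Rightarrow> ('a, 'e::euclidean_space) chart set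
    \<Rightarrow> ('a \<Rightarrow> ('a, 'e) tangent \<Rightarrow> ('a, 'e) tangent \<Rightarrow> real) \<Rightarrow> bool"
  where "pseudo_riemannian_metric M A g \<longleftrightarrow>
    (\<forall>p\<in>topspace M.
       (\<forall>v\<in>tangent_space A p. linear_map_on (tangent_space A p) (g p v)) \<and>
       (\<forall>v\<in>tangent_space A p. \<forall>w\<in>tangent_space A p. g p v w = g p w v) \<and>
       (\<forall>v\<in>tangent_space A p. (\<forall>w\<in>tangent_space A p. g p v w = 0) \<longrightarrow> v = 0)) \<and>
    (\<forall>W X Y. openin M W \<and> vector_field A W X \<and> vector_field A W Y \<longrightarrow>
       smooth_function A W (\<lambda>p. g p (X p) (Y p)))"

text \<open>\<open>nabla p v Y\<close> is \<open>\<nabla>\<^sub>v Y\<close> for \<open>v\<close> in the tangent space at \<open>p\<close> and a smooth vector field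
  \<open>Y\<close> on an open neighbourhood of \<open>p\<close>. The first condition makes it
  depend only on the germ of \<open>Y\<close> at \<open>p\<close>; such operators correspond one-to-one to affine
  connections acting on globally defined vector fields, apart from irrelevant values at other
  arguments.\<close>

type_synonym ('a, 'e) connection =
  "'a \<Rightarrow> ('a, 'e) tangent \<Rightarrow> ('a \<Rightarrow> ('a, 'e) tangent) \<Rightarrow> ('a, 'e) tangent"

definition affine_connection ::
  "'a topology \<Rightarrow> ('a, 'e::euclidean_space) chart set \<Rightarrow> ('a, 'e) connection \<Rightarrow> bool"
  where "affine_connection M A nabla \<longleftrightarrow>
    (\<forall>W Y Z. openin M W \<and> vector_field A W Y \<and> (\<forall>p\<in>W. Y p = Z p) \<longrightarrow>
       (\<forall>p\<in>W. \<forall>v\<in>tangent_space A p. nabla p v Y = nabla p v Z)) \<and>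
    (\<forall>W Y. openin M W \<and> vector_field A W Y \<longrightarrow>
       (\<forall>p\<in>W. (\<forall>v\<in>tangent_space A p. nabla p v Y \<in> tangent_space A p) \<and>
               linear_map_on (tangent_space A p) (\<lambda>v. nabla p v Y))) \<and>
    (\<forall>W Y Z. openin M W \<and> vector_field A W Y \<and> vector_field A W Z \<longrightarrow>
       (\<forall>p\<in>W. \<forall>v\<in>tangent_space A p.
          nabla p v (\<lambda>q. Y q + Z q) = nabla p v Y + nabla p v Z)) \<and>
    (\<forall>W f Y. openin M W \<and> smooth_function A W f \<and> vector_field A W Y \<longrightarrow>
       (\<forall>p\<in>W. \<forall>v\<in>tangent_space A p.
          nabla p v (\<lambda>q. f q *\<^sub>R Y q) = tangent_deriv A p v f *\<^sub>R Y p + f p *\<^sub>R nabla p v Y)) \<and>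
    (\<forall>W X Y. openin M W \<and> vector_field A W X \<and> vector_field A W Y \<longrightarrow>
       vector_field A W (\<lambda>p. nabla p (X p) Y))"

definition levi_civita ::
  "'a topology \<Rightarrow> ('a, 'e::euclidean_space) chart set
    \<Rightarrow> ('a \<Rightarrow> ('a, 'e) tangent \<Rightarrow> ('a, 'e) tangent \<Rightarrow> real) \<Rightarrow> ('a, 'e) connection \<Rightarrow> bool"
  where "levi_civita M A g nabla \<longleftrightarrow>
    affine_connection M A nabla \<and>
    (\<forall>W X Y. openin M W \<and> vector_field A W X \<and> vector_field A W Y \<longrightarrow>
       (\<forall>p\<in>W. nabla p (X p) Y - nabla p (Y p) X = lie_bracket A X Y p)) \<and>
    (\<forall>W Y Z. openin M W \<and> vector_field A W Y \<and> vector_field A W Z \<longrightarrow>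
       (\<forall>p\<in>W. \<forall>v\<in>tangent_space A p.
          tangent_deriv A p v (\<lambda>q. g q (Y q) (Z q))
            = g p (nabla p v Y) (Z p) + g p (Y p) (nabla p v Z)))"


section \<open>Almost contact B-metric manifolds\<close>

definition almost_contact_B_metric ::
  "'a topology \<Rightarrow> ('a, 'e::euclidean_space) chart set
    \<Rightarrow> ('a \<Rightarrow> ('a, 'e) tangent \<Rightarrow> ('a, 'e) tangent) \<Rightarrow> ('a \<Rightarrow> ('a, 'e) tangent)
    \<Rightarrow> ('a \<Rightarrow> ('a, 'e) tangent \<Rightarrow> real)
    \<Rightarrow> ('a \<Rightarrow> ('a, 'e) tangent \<Rightarrow> ('a, 'e) tangent \<Rightarrow> real) \<Rightarrow> bool"
  where "almost_contact_B_metric M A \<phi> \<xi> \<eta> g \<longleftrightarrow>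
    smooth_manifold M A \<and>
    (\<forall>p\<in>topspace M. linear_map_on (tangent_space A p) (\<phi> p) \<and>
       \<phi> p ` tangent_space A p \<subseteq> tangent_space A p) \<and>
    (\<forall>W X. openin M W \<and> vector_field A W X \<longrightarrow> vector_field A W (\<lambda>p. \<phi> p (X p))) \<and>
    vector_field A (topspace M) \<xi> \<and>
    (\<forall>p\<in>topspace M. linear_map_on (tangent_space A p) (\<eta> p)) \<and>
    (\<forall>W X. openin M W \<and> vector_field A W X \<longrightarrow> smooth_function A W (\<lambda>p. \<eta> p (X p))) \<and>
    pseudo_riemannian_metric M A g \<and>
    (\<forall>p\<in>topspace M.
       (\<forall>v\<in>tangent_space A p. \<phi> p (\<phi> p v) = - v + \<eta> p v *\<^sub>R \<xi> p) \<and>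
       \<eta> p (\<xi> p) = 1 \<and>
       (\<forall>v\<in>tangent_space A p. \<forall>w\<in>tangent_space A p.
          g p (\<phi> p v) (\<phi> p w) = - g p v w + \<eta> p v * \<eta> p w))"

text \<open>Here \<open>(\<nabla>\<^sub>X \<phi>) Y = \<nabla>\<^sub>X (\<phi> Y) - \<phi> (\<nabla>\<^sub>X Y)\<close>.\<close>

definition sasaki_like ::
  "'a topology \<Rightarrow> ('a, 'e::euclidean_space) chart set
    \<Rightarrow> ('a \<Rightarrow> ('a, 'e) tangent \<Rightarrow> ('a, 'e) tangent) \<Rightarrow> ('a \<Rightarrow> ('a, 'e) tangent)
    \<Rightarrow> ('a \<Rightarrow> ('a, 'e) tangent \<Rightarrow> real)
    \<Rightarrow> ('a \<Rightarrow> ('a, 'e) tangent \<Rightarrow> ('a, 'e) tangent \<Rightarrow> real) \<Rightarrow> ('a, 'e) connection \<Rightarrow> bool"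
  where "sasaki_like M A \<phi> \<xi> \<eta> g nabla \<longleftrightarrow>
    (\<forall>W X Y. openin M W \<and> vector_field A W X \<and> vector_field A W Y \<longrightarrow>
       (\<forall>p\<in>W. nabla p (X p) (\<lambda>q. \<phi> q (Y q)) - \<phi> p (nabla p (X p) Y)
          = - (g p (X p) (Y p) *\<^sub>R \<xi> p) - \<eta> p (Y p) *\<^sub>R X p
            + (2 * \<eta> p (X p) * \<eta> p (Y p)) *\<^sub>R \<xi> p))"


section \<open>Curves\<close>

definition smooth_curve ::
  "'a topology \<Rightarrow> ('a, 'e::euclidean_space) chart set \<Rightarrow> real set \<Rightarrow> (real \<Rightarrow> 'a) \<Rightarrow> bool"
  where "smooth_curve M A I C \<longleftrightarrow>
    is_interval I \<and> interior I \<noteq> {} \<and>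
    continuous_map (top_of_set I) M C \<and>
    (\<forall>c\<in>A. smooth_on_real {t\<in>I. C t \<in> fst c} (snd c \<circ> C))"

definition velocity ::
  "('a, 'e::euclidean_space) chart set \<Rightarrow> real set \<Rightarrow> (real \<Rightarrow> 'a) \<Rightarrow> real \<Rightarrow> ('a, 'e) tangent"
  where "velocity A I C t =
    (\<lambda>c. if c \<in> charts_at A (C t) then vector_derivative (snd c \<circ> C) (at t within I) else 0)"

definition vector_field_along ::
  "('a, 'e::euclidean_space) chart set \<Rightarrow> real set \<Rightarrow> (real \<Rightarrow> 'a)
    \<Rightarrow> (real \<Rightarrow> ('a, 'e) tangent) \<Rightarrow> bool"
  where "vector_field_along A I C V \<longleftrightarrow>
    (\<forall>t\<in>I. V t \<in> tangent_space A (C t)) \<and>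
    (\<forall>c\<in>A. smooth_on_real {t\<in>I. C t \<in> fst c} (\<lambda>t. V t c))"

text \<open>The covariant derivative of a vector field \<open>V = V\<^sup>i \<partial>\<^sub>i\<close> along \<open>C\<close>: its components in a
  chart are those of \<open>(dV\<^sup>i/dt) \<partial>\<^sub>i + V\<^sup>i \<nabla>\<^bsub>dC/dt\<^esub> \<partial>\<^sub>i\<close>.\<close>

definition covariant_deriv_along ::
  "('a, 'e::euclidean_space) chart set \<Rightarrow> ('a, 'e) connection \<Rightarrow> real set \<Rightarrow> (real \<Rightarrow> 'a)
    \<Rightarrow> (real \<Rightarrow> ('a, 'e) tangent) \<Rightarrow> real \<Rightarrow> ('a, 'e) tangent"
  where "covariant_deriv_along A nabla I C V t =
    (\<lambda>c. if c \<in> charts_at A (C t)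
         then vector_derivative (\<lambda>s. V s c) (at t within I)
            + (\<Sum>i\<in>Basis. (V t c \<bullet> i) *\<^sub>R nabla (C t) (velocity A I C t) (coord_field A c i) c)
         else 0)"

definition null_curve ::
  "'a topology \<Rightarrow> ('a, 'e::euclidean_space) chart set
    \<Rightarrow> ('a \<Rightarrow> ('a, 'e) tangent \<Rightarrow> ('a, 'e) tangent \<Rightarrow> real) \<Rightarrow> real set \<Rightarrow> (real \<Rightarrow> 'a) \<Rightarrow> bool"
  where "null_curve M A g I C \<longleftrightarrow>
    smooth_curve M A I C \<and>
    (\<forall>t\<in>I. g (C t) (velocity A I C t) (velocity A I C t) = 0 \<and> velocity A I C t \<noteq> 0)"

definition legendre_curve ::
  "'a topology \<Rightarrow> ('a, 'e::euclidean_space) chart set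
    \<Rightarrow> ('a \<Rightarrow> ('a, 'e) tangent \<Rightarrow> real) \<Rightarrow> real set \<Rightarrow> (real \<Rightarrow> 'a) \<Rightarrow> bool"
  where "legendre_curve M A \<eta> I C \<longleftrightarrow>
    smooth_curve M A I C \<and> (\<forall>t\<in>I. \<eta> (C t) (velocity A I C t) = 0)"

text \<open>\<open>{dC/dt, N, W}\<close> is a general Frenet frame along the null curve \<open>C\<close>.\<close>

definition general_frenet_frame ::
  "('a, 'e::euclidean_space) chart set
    \<Rightarrow> ('a \<Rightarrow> ('a, 'e) tangent \<Rightarrow> ('a, 'e) tangent \<Rightarrow> real) \<Rightarrow> real set \<Rightarrow> (real \<Rightarrow> 'a)
    \<Rightarrow> (real \<Rightarrow> ('a, 'e) tangent) \<Rightarrow> (real \<Rightarrow> ('a, 'e) tangent) \<Rightarrow> bool"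
  where "general_frenet_frame A g I C N W \<longleftrightarrow>
    vector_field_along A I C N \<and> vector_field_along A I C W \<and>
    (\<forall>t\<in>I. g (C t) (velocity A I C t) (N t) = 1 \<and> g (C t) (W t) (W t) = 1 \<and>
           g (C t) (N t) (N t) = 0 \<and> g (C t) (N t) (W t) = 0 \<and>
           g (C t) (velocity A I C t) (W t) = 0)"

text \<open>The curvature \<open>k\<^sub>1\<close> with respect to a general Frenet frame with last member \<open>W\<close>.\<close>

definition frenet_k1 ::
  "('a, 'e::euclidean_space) chart set \<Rightarrow> ('a, 'e) connection \<Rightarrow> real set \<Rightarrow> (real \<Rightarrow> 'a)
    \<Rightarrow> (real \<Rightarrow> ('a, 'e) tangent) \<Rightarrow> real \<Rightarrow> real"
  where "frenet_k1 A nabla I C W t =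
    (THE k. \<exists>h. covariant_deriv_along A nabla I C (velocity A I C) t
                  = h *\<^sub>R velocity A I C t + k *\<^sub>R W t)"

end

theory Submission
  imports Defs
begin

text \<open>
Write \<open>v\<close> for the velocity and \<open>a\<close> for its covariant derivative along the curve. The three vectors
\<open>v\<close>, \<open>\<phi> v\<close>, \<open>\<xi>\<close> form a basis of the tangent space at each point of the curve, and among their
products only \<open>g(v, \<phi> v) = b\<close> and \<open>g(\<xi>, \<xi>) = 1\<close> are nonzero; that \<open>b\<close> is nonzero is forced by
nondegeneracy of \<open>g\<close> (\<open>null_legendre_b_nonzero\<close>). So \<open>a\<close> is determined by its products with these
three vectors (\<open>null_legendre_expansion\<close>), and these come from differentiating along the curve.

  \<^item> From \<open>g(v, v) = 0\<close>: \<open>g(a, v) = 0\<close>.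
  \<^item> From \<open>0 = \<eta>(v) = g(v, \<xi>)\<close> and \<open>\<nabla>\<^sub>v \<xi> = - \<phi> v\<close>: \<open>g(a, \<xi>) = g(v, \<phi> v) = b\<close>.
  \<^item> The Sasaki-like condition gives \<open>(\<nabla>\<^sub>v \<phi>) v = 0\<close>, as \<open>v\<close> is null and \<open>\<eta>(v) = 0\<close>. Since \<open>\<phi>\<close> is
    symmetric for \<open>g\<close>, the derivative of \<open>b = g(v, \<phi> v)\<close> is \<open>2 g(a, \<phi> v)\<close>.

Hence \<open>a = b \<xi> + (b' / 2 b) v\<close>. The member \<open>W\<close> of a general Frenet frame is a unit vector orthogonal
to \<open>v\<close>, so \<open>W = x v + \<eta>(W) \<xi>\<close> with \<open>\<eta>(W)\<^sup>2 = 1\<close>. Comparing coefficients gives \<open>k\<^sub>1 = \<eta>(W) b\<close>, and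
the sign \<open>\<eta>(W)\<close> is constant because it is continuous on an interval.

All derivatives along the curve are instances of one product rule, \<open>metric_compatible_along\<close>, for
fields along the curve written as combinations of vector fields on an open set of the manifold. The
vector fields used are the coordinate fields of a chart, their images under \<open>\<phi>\<close>, and \<open>\<xi>\<close>. That
coordinate fields are smooth in every other chart rests on the chain rule for smooth maps.
\<close>

section \<open>Closure properties of smooth maps\<close>

lemma Ck_on_subset: "Ck_on k T f \<Longrightarrow> S \<subseteq> T \<Longrightarrow> Ck_on k S f"
proof (induction k arbitrary: f)
  case 0
  then show ?case by (auto intro: continuous_on_subset)
next
  case (Suc k)
  then show ?case by (auto 0 3)
qed

lemma Ck_on_cong:
  assumes "open S" "\<And>x. x \<in> S \<Longrightarrow> f x = h x" "Ck_on k S f"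
  shows "Ck_on k S h"
  using assms(2,3)
proof (induction k arbitrary: f h)
  case 0
  then show ?case using continuous_on_cong[of S S f h] by auto
next
  case (Suc k)
  have D: "(h has_derivative frechet_derivative f (at x)) (at x)" if "x \<in> S" for x
    using has_derivative_transform_within_open[OF _ assms(1) that, of f _ UNIV h] Suc.prems that
    by (auto simp: frechet_derivative_works)
  have eq: "frechet_derivative h (at x) = frechet_derivative f (at x)" if "x \<in> S" for x
    using frechet_derivative_at[OF D[OF that]] by simp
  have "Ck_on k S (\<lambda>x. frechet_derivative h (at x) v)" for v
    using Suc.IH[of "\<lambda>x. frechet_derivative f (at x) v" "\<lambda>x. frechet_derivative h (at x) v"]
      Suc.prems eq by simp
  then show ?case using D by (auto simp: differentiable_def)
qed

lemma Ck_on_SucI: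
  assumes "open S" "\<And>x. x \<in> S \<Longrightarrow> (f has_derivative D x) (at x)"
    and "\<And>v. Ck_on k S (\<lambda>x. D x v)"
  shows "Ck_on (Suc k) S f"
proof -
  have "Ck_on k S (\<lambda>x. frechet_derivative f (at x) v)" for v
    by (rule Ck_on_cong[OF assms(1) _ assms(3)[of v]]) (metis frechet_derivative_at[OF assms(2)])
  then show ?thesis using assms(2) by (auto simp: differentiable_def)
qed

lemma Ck_on_SucD: "Ck_on (Suc k) S f \<Longrightarrow> Ck_on k S f"
proof (induction k arbitrary: f)
  case 0
  then show ?case
    by (auto intro!: continuous_at_imp_continuous_on differentiable_imp_continuous_within)
next
  case (Suc k)
  then show ?case by (metis Ck_on.simps(2))
qed

lemma Ck_on_has_derivative:
  "Ck_on (Suc k) S f \<Longrightarrow> x \<in> S \<Longrightarrow> (f has_derivative frechet_derivative f (at x)) (at x)"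
  by (auto simp: frechet_derivative_works)

lemma Ck_on_const: "open S \<Longrightarrow> Ck_on k S (\<lambda>x. c)"
proof (induction k arbitrary: c)
  case (Suc k)
  then show ?case by (intro Ck_on_SucI[where D = "\<lambda>_ _. 0"]) auto
qed auto

lemma Ck_on_add:
  "open S \<Longrightarrow> Ck_on k S f \<Longrightarrow> Ck_on k S h \<Longrightarrow> Ck_on k S (\<lambda>x. f x + h x)"
proof (induction k arbitrary: f h)
  case 0
  then show ?case by (auto intro: continuous_on_add)
next
  case (Suc k)
  show ?case
  proof (rule Ck_on_SucI[OF Suc.prems(1)])
    show "((\<lambda>x. f x + h x) has_derivative
        (\<lambda>v. frechet_derivative f (at x) v + frechet_derivative h (at x) v)) (at x)" if "x \<in> S" for x
      using that Suc.prems by (intro has_derivative_add Ck_on_has_derivative)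
  qed (use Suc in auto)
qed

lemma Ck_on_sum:
  "open S \<Longrightarrow> (\<And>i. i \<in> J \<Longrightarrow> Ck_on k S (f i)) \<Longrightarrow> Ck_on k S (\<lambda>x. \<Sum>i\<in>J. f i x)"
  by (induction J rule: infinite_finite_induct) (auto simp: Ck_on_const Ck_on_add)

lemma Ck_on_inner:
  "open S \<Longrightarrow> Ck_on k S f \<Longrightarrow> Ck_on k S (\<lambda>x. f x \<bullet> c)"
proof (induction k arbitrary: f)
  case 0
  then show ?case by (auto intro: continuous_intros)
next
  case (Suc k)
  show ?case
  proof (rule Ck_on_SucI[OF Suc.prems(1)])
    show "((\<lambda>x. f x \<bullet> c) has_derivative (\<lambda>v. frechet_derivative f (at x) v \<bullet> c)) (at x)"
      if "x \<in> S" for x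
      using that Suc.prems by (intro has_derivative_inner_left Ck_on_has_derivative)
  qed (use Suc in auto)
qed

lemma Ck_on_scaleR:
  fixes r :: "'e::real_normed_vector \<Rightarrow> real"
  shows "open S \<Longrightarrow> Ck_on k S r \<Longrightarrow> Ck_on k S f \<Longrightarrow> Ck_on k S (\<lambda>x. r x *\<^sub>R f x)"
proof (induction k arbitrary: r f)
  case 0
  then show ?case by (auto intro: continuous_intros)
next
  case (Suc k)
  show ?case
  proof (rule Ck_on_SucI[OF Suc.prems(1)])
    show "((\<lambda>x. r x *\<^sub>R f x) has_derivative
        (\<lambda>v. r x *\<^sub>R frechet_derivative f (at x) v + frechet_derivative r (at x) v *\<^sub>R f x)) (at x)"
      if "x \<in> S" for x
      using that Suc.prems by (intro has_derivative_scaleR Ck_on_has_derivative)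
    show "Ck_on k S (\<lambda>x. r x *\<^sub>R frechet_derivative f (at x) v + frechet_derivative r (at x) v *\<^sub>R f x)"
      for v
      using Suc.prems Ck_on_SucD[OF Suc.prems(2)] Ck_on_SucD[OF Suc.prems(3)]
      by (intro Ck_on_add Suc.IH) auto
  qed
qed

text \<open>The chain rule writes a directional derivative of the composite as a combination of the
  partial derivatives of the outer map at the image point; these are again composites, of one
  order of differentiability less.\<close>

lemma Ck_on_compose:
  fixes f :: "'e::euclidean_space \<Rightarrow> 'f::real_normed_vector"
    and h :: "'d::real_normed_vector \<Rightarrow> 'e"
  assumes "open S"
  shows "Ck_on k T f \<Longrightarrow> Ck_on k S h \<Longrightarrow> h ` S \<subseteq> T \<Longrightarrow> Ck_on k S (\<lambda>x. f (h x))"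
proof (induction k arbitrary: f)
  case 0
  then show ?case using continuous_on_compose2[of T f S h] by auto
next
  case (Suc k)
  let ?f = "\<lambda>x. frechet_derivative f (at (h x))" and ?h = "\<lambda>x. frechet_derivative h (at x)"
  show ?case
  proof (rule Ck_on_SucI[OF assms])
    fix x assume x: "x \<in> S"
    have f: "(f has_derivative ?f x) (at (h x))"
      using Suc.prems x by (intro Ck_on_has_derivative) auto
    have h: "(h has_derivative ?h x) (at x)"
      using Suc.prems x by (intro Ck_on_has_derivative)
    have "?f x (?h x v) = (\<Sum>i\<in>Basis. (?h x v \<bullet> i) *\<^sub>R ?f x i)" for v
      using linear_sum[OF has_derivative_linear[OF f], of "\<lambda>i. (?h x v \<bullet> i) *\<^sub>R i" Basis]
      by (simp add: euclidean_representation linear_scale[OF has_derivative_linear[OF f]])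
    then show "((\<lambda>x. f (h x)) has_derivative (\<lambda>v. \<Sum>i\<in>Basis. (?h x v \<bullet> i) *\<^sub>R ?f x i)) (at x)"
      using has_derivative_compose[OF h f] by simp
  next
    fix v
    show "Ck_on k S (\<lambda>x. \<Sum>i\<in>Basis. (?h x v \<bullet> i) *\<^sub>R ?f x i)"
      using Suc.prems Ck_on_SucD[OF Suc.prems(2)]
      by (intro Ck_on_sum Ck_on_scaleR Ck_on_inner assms Suc.IH) auto
  qed
qed

lemma smooth_on_subset: "smooth_on T f \<Longrightarrow> S \<subseteq> T \<Longrightarrow> smooth_on S f"
  unfolding smooth_on_def using Ck_on_subset by blast

lemma smooth_on_has_derivative:
  "smooth_on S f \<Longrightarrow> x \<in> S \<Longrightarrow> (f has_derivative frechet_derivative f (at x)) (at x)"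
  unfolding smooth_on_def using Ck_on_has_derivative by blast

lemma smooth_on_frechet_derivative:
  "smooth_on S f \<Longrightarrow> smooth_on S (\<lambda>x. frechet_derivative f (at x) v)"
  unfolding smooth_on_def by (metis Ck_on.simps(2))

lemma smooth_on_cong:
  "open S \<Longrightarrow> (\<And>x. x \<in> S \<Longrightarrow> f x = h x) \<Longrightarrow> smooth_on S f \<Longrightarrow> smooth_on S h"
  unfolding smooth_on_def using Ck_on_cong by blast

lemma smooth_on_compose:
  fixes f :: "'e::euclidean_space \<Rightarrow> 'f::real_normed_vector"
  shows "open S \<Longrightarrow> smooth_on T f \<Longrightarrow> smooth_on S h \<Longrightarrow> h ` S \<subseteq> T
    \<Longrightarrow> smooth_on S (\<lambda>x. f (h x))"
  unfolding smooth_on_def using Ck_on_compose by blast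


section \<open>Charts, tangent spaces and coordinate fields\<close>

lemma sum_fun_apply: "(\<Sum>i\<in>J. f i) x = (\<Sum>i\<in>J. f i x)"
  by (induction J rule: infinite_finite_induct) auto

lemma scaleR_fun_apply [simp]: "(r *\<^sub>R f) x = r *\<^sub>R f x"
  by (simp add: scaleR_fun_def)

locale smooth_atlas =
  fixes M :: "'a topology" and A :: "('a, 'e::euclidean_space) chart set"
  assumes manifold: "smooth_manifold M A"
begin

lemma chart_openin: "c \<in> A \<Longrightarrow> openin M (fst c)"
  using manifold by (auto simp: smooth_manifold_def)

lemma chart_exists: "p \<in> topspace M \<Longrightarrow> \<exists>c. c \<in> charts_at A p"
  using manifold by (fastforce simp: smooth_manifold_def charts_at_def)

lemma chart_homeomorphic:
  "c \<in> A \<Longrightarrow> homeomorphic_map (subtopology M (fst c)) (top_of_set (snd c ` fst c)) (snd c)"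
  using manifold by (auto simp: smooth_manifold_def)

lemma chart_topspace: "c \<in> A \<Longrightarrow> topspace (subtopology M (fst c)) = fst c"
  using openin_subset[OF chart_openin, of c] by (simp add: Int_absorb1)

lemma chart_inj: "c \<in> A \<Longrightarrow> inj_on (snd c) (fst c)"
  using homeomorphic_imp_injective_map[OF chart_homeomorphic] chart_topspace by metis

lemma chart_inv_left [simp]: "c \<in> A \<Longrightarrow> p \<in> fst c \<Longrightarrow> chart_inv c (snd c p) = p"
  by (simp add: chart_inv_def chart_inj)

lemma chart_image_open:
  assumes "c \<in> A" "openin M W"
  shows "open (snd c ` (W \<inter> fst c))"
proof -
  have "openin (subtopology M (fst c)) (W \<inter> fst c)"
    using assms by (simp add: openin_subtopology_Int)
  then have "openin (top_of_set (snd c ` fst c)) (snd c ` (W \<inter> fst c))"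
    using homeomorphic_imp_open_map[OF chart_homeomorphic[OF assms(1)]] by (auto simp: open_map_def)
  moreover have "open (snd c ` fst c)"
    using manifold assms by (auto simp: smooth_manifold_def)
  ultimately show ?thesis by (simp add: openin_open_eq)
qed

lemma transition_apply: "c \<in> A \<Longrightarrow> p \<in> fst c \<Longrightarrow> transition c d (snd c p) = snd d p"
  by (simp add: transition_def)

lemma transition_smooth:
  "c \<in> A \<Longrightarrow> d \<in> A \<Longrightarrow> smooth_on (snd c ` (fst c \<inter> fst d)) (transition c d)"
  using manifold by (auto simp: smooth_manifold_def)

lemma transition_has_derivative:
  assumes "c \<in> charts_at A p" "d \<in> charts_at A p"
  shows "(transition c d has_derivative frechet_derivative (transition c d) (at (snd c p))) (at (snd c p))"
  using assms by (intro smooth_on_has_derivative[OF transition_smooth]) (auto simp: charts_at_def)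

lemma transition_linear:
  "c \<in> charts_at A p \<Longrightarrow> d \<in> charts_at A p \<Longrightarrow>
    linear (frechet_derivative (transition c d) (at (snd c p)))"
  using has_derivative_linear[OF transition_has_derivative] .

lemma transition_cocycle:
  assumes "c \<in> charts_at A p" "d \<in> charts_at A p" "e \<in> charts_at A p"
  shows "frechet_derivative (transition d e) (at (snd d p))
      (frechet_derivative (transition c d) (at (snd c p)) v)
    = frechet_derivative (transition c e) (at (snd c p)) v"
proof -
  let ?S = "snd c ` (fst d \<inter> fst c)"
  have A: "c \<in> A" "d \<in> A" "e \<in> A" and p: "p \<in> fst c" "p \<in> fst d" "p \<in> fst e"
    using assms by (auto simp: charts_at_def)
  have "((\<lambda>x. transition d e (transition c d x)) has_derivative
      (\<lambda>v. frechet_derivative (transition d e) (at (snd d p))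
        (frechet_derivative (transition c d) (at (snd c p)) v))) (at (snd c p))"
    using has_derivative_compose[OF transition_has_derivative[OF assms(1,2)]]
      transition_has_derivative[OF assms(2,3)] transition_apply[OF A(1) p(1)] by simp
  then have "(transition c e has_derivative
      (\<lambda>v. frechet_derivative (transition d e) (at (snd d p))
        (frechet_derivative (transition c d) (at (snd c p)) v))) (at (snd c p))"
    by (rule has_derivative_transform_within_open[OF _ chart_image_open[OF A(1) chart_openin[OF A(2)]]])
      (use A p in \<open>auto simp: transition_apply\<close>)
  from frechet_derivative_at[OF this] show ?thesis by (rule fun_cong)
qed

lemma transition_self:
  assumes "c \<in> charts_at A p"
  shows "frechet_derivative (transition c c) (at (snd c p)) v = v"
proof -
  have c: "c \<in> A" "p \<in> fst c" using assms by (auto simp: charts_at_def)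
  have "((\<lambda>x. x) has_derivative (\<lambda>v. v)) (at (snd c p))" by simp
  then have "(transition c c has_derivative (\<lambda>v. v)) (at (snd c p))"
    by (rule has_derivative_transform_within_open[OF _ chart_image_open[OF c(1) chart_openin[OF c(1)]]])
      (use c in \<open>auto simp: transition_apply\<close>)
  from fun_cong[OF frechet_derivative_at[OF this], of v] show ?thesis by simp
qed

lemma tangent_space_transition:
  "v \<in> tangent_space A p \<Longrightarrow> c \<in> charts_at A p \<Longrightarrow> d \<in> charts_at A p \<Longrightarrow>
    v d = frechet_derivative (transition c d) (at (snd c p)) (v c)"
  unfolding tangent_space_def by blast

lemma tangent_space_outside: "v \<in> tangent_space A p \<Longrightarrow> d \<notin> charts_at A p \<Longrightarrow> v d = 0"
  unfolding tangent_space_def by blast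

lemma tangent_spaceI:
  "(\<And>d. d \<notin> charts_at A p \<Longrightarrow> v d = 0) \<Longrightarrow>
    (\<And>c d. c \<in> charts_at A p \<Longrightarrow> d \<in> charts_at A p \<Longrightarrow>
      v d = frechet_derivative (transition c d) (at (snd c p)) (v c)) \<Longrightarrow>
    v \<in> tangent_space A p"
  unfolding tangent_space_def by blast

lemma subspace_tangent_space: "subspace (tangent_space A p)"
proof (rule subspaceI)
  show "0 \<in> tangent_space A p"
    by (simp add: tangent_space_def linear_0[OF transition_linear])
next
  fix v w assume v: "v \<in> tangent_space A p" and w: "w \<in> tangent_space A p"
  show "v + w \<in> tangent_space A p"
  proof (rule tangent_spaceI)
    fix c d assume cd: "c \<in> charts_at A p" "d \<in> charts_at A p"
    show "(v + w) d = frechet_derivative (transition c d) (at (snd c p)) ((v + w) c)"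
      unfolding plus_fun_apply linear_add[OF transition_linear[OF cd]]
      by (rule arg_cong2[where f = "(+)"])
        (rule tangent_space_transition[OF v cd] tangent_space_transition[OF w cd])+
  qed (simp add: tangent_space_outside[OF v] tangent_space_outside[OF w])
next
  fix r v assume v: "v \<in> tangent_space A p"
  show "r *\<^sub>R v \<in> tangent_space A p"
  proof (rule tangent_spaceI)
    fix c d assume cd: "c \<in> charts_at A p" "d \<in> charts_at A p"
    show "(r *\<^sub>R v) d = frechet_derivative (transition c d) (at (snd c p)) ((r *\<^sub>R v) c)"
      unfolding scaleR_fun_apply linear_scale[OF transition_linear[OF cd]]
      by (rule arg_cong[OF tangent_space_transition[OF v cd]])
  qed (simp add: tangent_space_outside[OF v])
qed

lemma coord_field_self [simp]: "c \<in> charts_at A p \<Longrightarrow> coord_field A c e p c = e"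
  by (simp add: coord_field_def transition_self)

lemma coord_field_tangent: "c \<in> charts_at A p \<Longrightarrow> coord_field A c e p \<in> tangent_space A p"
  by (auto simp: tangent_space_def coord_field_def transition_cocycle)

lemma tangent_eq_coord_field:
  "c \<in> charts_at A p \<Longrightarrow> v \<in> tangent_space A p \<Longrightarrow> coord_field A c (v c) p = v"
  by (rule ext) (simp add: coord_field_def tangent_space_outside flip: tangent_space_transition)

lemma coord_field_eq_sum:
  assumes "c \<in> charts_at A p"
  shows "coord_field A c e p = (\<Sum>i\<in>Basis. (e \<bullet> i) *\<^sub>R coord_field A c i p)"
proof
  fix d
  show "coord_field A c e p d = (\<Sum>i\<in>Basis. (e \<bullet> i) *\<^sub>R coord_field A c i p) d"
  proof (cases "d \<in> charts_at A p")
    case True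
    note l = transition_linear[OF assms True]
    have "frechet_derivative (transition c d) (at (snd c p)) e
        = (\<Sum>i\<in>Basis. (e \<bullet> i) *\<^sub>R frechet_derivative (transition c d) (at (snd c p)) i)"
      using linear_sum[OF l, of "\<lambda>i. (e \<bullet> i) *\<^sub>R i" Basis]
      by (simp only: euclidean_representation linear_scale[OF l])
    then show ?thesis
      using True by (simp add: coord_field_def sum_fun_apply)
  qed (simp add: coord_field_def sum_fun_apply)
qed

lemma tangent_eq_sum:
  "c \<in> charts_at A p \<Longrightarrow> v \<in> tangent_space A p \<Longrightarrow>
    v = (\<Sum>i\<in>Basis. (v c \<bullet> i) *\<^sub>R coord_field A c i p)"
  using tangent_eq_coord_field[of c p v] coord_field_eq_sum[of c p "v c"] by simp

text \<open>In another chart the components of a coordinate field are a column of the Jacobian of the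
  transition map, taken at the corresponding point: a composite of smooth maps.\<close>

lemma vector_field_coord:
  assumes "c \<in> A"
  shows "vector_field A (fst c) (coord_field A c e)"
proof -
  have "smooth_on (snd d ` (fst c \<inter> fst d)) (\<lambda>x. coord_field A c e (chart_inv d x) d)"
    if d: "d \<in> A" for d
  proof (rule smooth_on_cong)
    show o: "open (snd d ` (fst c \<inter> fst d))"
      using chart_image_open[OF d chart_openin[OF assms]] .
    show "smooth_on (snd d ` (fst c \<inter> fst d))
        (\<lambda>x. frechet_derivative (transition c d) (at (transition d c x)) e)"
    proof (rule smooth_on_compose[OF o smooth_on_frechet_derivative[OF transition_smooth[OF assms d]]])
      show "smooth_on (snd d ` (fst c \<inter> fst d)) (transition d c)"
        using transition_smooth[OF d assms] by (simp add: inf_commute)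
    qed (use d in \<open>auto simp: transition_apply\<close>)
  qed (use assms d in \<open>auto simp: coord_field_def charts_at_def transition_apply\<close>)
  then show ?thesis
    using assms by (auto simp: vector_field_def charts_at_def intro!: coord_field_tangent)
qed

lemma vector_field_subset: "vector_field A W X \<Longrightarrow> V \<subseteq> W \<Longrightarrow> vector_field A V X"
  unfolding vector_field_def by (meson Int_mono image_mono smooth_on_subset subset_iff subset_refl)

lemma tangent_deriv_locally_const:
  assumes "openin M W" "p \<in> W" "\<And>q. q \<in> W \<Longrightarrow> f q = (k::real)"
  shows "tangent_deriv A p v f = 0"
proof -
  define c where "c = (SOME c. c \<in> charts_at A p)"
  have "c \<in> charts_at A p"
    unfolding c_def using chart_exists[of p] openin_subset[OF assms(1)] assms(2)
    by (meson someI_ex subsetD)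
  then have c: "c \<in> A" "p \<in> fst c" by (auto simp: charts_at_def)
  have "((\<lambda>x. k) has_derivative (\<lambda>v. 0)) (at (snd c p))" by simp
  then have "((f \<circ> chart_inv c) has_derivative (\<lambda>v. 0)) (at (snd c p))"
    by (rule has_derivative_transform_within_open[OF _ chart_image_open[OF c(1) assms(1)]])
      (use assms c in auto)
  from fun_cong[OF frechet_derivative_at[OF this], of "v c"] show ?thesis
    unfolding tangent_deriv_def c_def[symmetric] Let_def by simp
qed

end


section \<open>Linear algebra of a single tangent space\<close>

lemma linear_map_on_0:
  assumes "linear_map_on T f" "subspace T"
  shows "f 0 = 0"
proof -
  have "f (0 *\<^sub>R 0) = 0 *\<^sub>R f 0"
    using assms subspace_0[OF assms(2)] unfolding linear_map_on_def by blast
  then show ?thesis by simp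
qed

lemma linear_map_on_sum:
  assumes "linear_map_on T f" "subspace T" "\<And>i. i \<in> J \<Longrightarrow> x i \<in> T"
  shows "f (\<Sum>i\<in>J. r i *\<^sub>R x i) = (\<Sum>i\<in>J. r i *\<^sub>R f (x i))"
  using assms(3)
proof (induction J rule: infinite_finite_induct)
  case (insert i J)
  have "(\<Sum>i\<in>J. r i *\<^sub>R x i) \<in> T"
    using insert assms(2) by (intro subspace_sum subspace_scale) auto
  then show ?case
    using insert assms(1) subspace_scale[OF assms(2)] by (simp add: linear_map_on_def)
qed (use linear_map_on_0[OF assms(1,2)] in auto)

text \<open>The structure that an almost contact B-metric induces on a three-dimensional tangent space.
  The ambient vector space of families indexed by all charts is infinite-dimensional, so the
  dimension is bounded through a spanning set.\<close>

locale contact_B_space =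
  fixes T :: "'v::real_vector set" and \<phi> :: "'v \<Rightarrow> 'v" and \<xi> :: 'v and \<eta> :: "'v \<Rightarrow> real"
    and g :: "'v \<Rightarrow> 'v \<Rightarrow> real"
  assumes subspace: "subspace T"
    and span: "\<exists>B. finite B \<and> card B \<le> 3 \<and> T \<subseteq> span B"
    and linear_phi: "linear_map_on T \<phi>" and phi_in: "\<And>v. v \<in> T \<Longrightarrow> \<phi> v \<in> T"
    and xi_in: "\<xi> \<in> T" and linear_eta: "linear_map_on T \<eta>"
    and linear_g: "\<And>v. v \<in> T \<Longrightarrow> linear_map_on T (g v)"
    and g_sym: "\<And>v w. v \<in> T \<Longrightarrow> w \<in> T \<Longrightarrow> g v w = g w v"
    and g_nondegenerate: "\<And>v. v \<in> T \<Longrightarrow> (\<And>w. w \<in> T \<Longrightarrow> g v w = 0) \<Longrightarrow> v = 0"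
    and phi_phi: "\<And>v. v \<in> T \<Longrightarrow> \<phi> (\<phi> v) = - v + \<eta> v *\<^sub>R \<xi>"
    and eta_xi: "\<eta> \<xi> = 1"
    and g_phi_phi: "\<And>v w. v \<in> T \<Longrightarrow> w \<in> T \<Longrightarrow> g (\<phi> v) (\<phi> w) = - g v w + \<eta> v * \<eta> w"
begin

lemmas closed = subspace_0[OF subspace] subspace_add[OF subspace] subspace_scale[OF subspace]
  subspace_neg[OF subspace] subspace_diff[OF subspace] phi_in xi_in

lemma phi_add: "v \<in> T \<Longrightarrow> w \<in> T \<Longrightarrow> \<phi> (v + w) = \<phi> v + \<phi> w"
  and phi_scale: "v \<in> T \<Longrightarrow> \<phi> (r *\<^sub>R v) = r *\<^sub>R \<phi> v"
  and eta_add: "v \<in> T \<Longrightarrow> w \<in> T \<Longrightarrow> \<eta> (v + w) = \<eta> v + \<eta> w"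
  and eta_scale: "v \<in> T \<Longrightarrow> \<eta> (r *\<^sub>R v) = r * \<eta> v"
  and g_add_right: "u \<in> T \<Longrightarrow> v \<in> T \<Longrightarrow> w \<in> T \<Longrightarrow> g u (v + w) = g u v + g u w"
  and g_scale_right: "u \<in> T \<Longrightarrow> v \<in> T \<Longrightarrow> g u (r *\<^sub>R v) = r * g u v"
  using linear_phi linear_eta linear_g by (auto simp: linear_map_on_def)

lemma g_add_left: "u \<in> T \<Longrightarrow> v \<in> T \<Longrightarrow> w \<in> T \<Longrightarrow> g (v + w) u = g v u + g w u"
  by (metis g_add_right g_sym closed(2))

lemma g_scale_left: "u \<in> T \<Longrightarrow> v \<in> T \<Longrightarrow> g (r *\<^sub>R v) u = r * g v u"
  by (metis g_scale_right g_sym closed(3))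

lemmas expand = phi_add phi_scale eta_add eta_scale g_add_right g_scale_right g_add_left g_scale_left

lemma phi_minus: "v \<in> T \<Longrightarrow> \<phi> (- v) = - \<phi> v"
  and g_minus_right: "u \<in> T \<Longrightarrow> v \<in> T \<Longrightarrow> g u (- v) = - g u v"
  and g_minus_left: "u \<in> T \<Longrightarrow> v \<in> T \<Longrightarrow> g (- v) u = - g v u"
  using phi_scale[of v "-1"] g_scale_right[of u v "-1"] g_scale_left[of u v "-1"]
  by auto

lemma phi_diff: "v \<in> T \<Longrightarrow> w \<in> T \<Longrightarrow> \<phi> (v - w) = \<phi> v - \<phi> w"
  and g_diff_left: "u \<in> T \<Longrightarrow> v \<in> T \<Longrightarrow> w \<in> T \<Longrightarrow> g (v - w) u = g v u - g w u"
  using phi_add[of v "- w"] phi_minus[of w] g_add_left[of u v "- w"] g_minus_left[of u w] closed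
  by simp_all

text \<open>Both \<open>\<phi> \<xi> = 0\<close> and \<open>\<eta> \<circ> \<phi> = 0\<close> come from computing \<open>\<phi>\<^sup>3\<close> in two ways.\<close>

lemma phi_xi: "\<phi> \<xi> = 0"
proof -
  have pp: "\<phi> (\<phi> \<xi>) = 0" using phi_phi[OF xi_in] eta_xi by simp
  have p0: "\<phi> 0 = 0" using linear_map_on_0[OF linear_phi subspace] .
  have e: "\<phi> \<xi> = \<eta> (\<phi> \<xi>) *\<^sub>R \<xi>"
    using phi_phi[OF phi_in[OF xi_in]] pp p0 by simp
  then have "0 = \<eta> (\<phi> \<xi>) *\<^sub>R \<phi> \<xi>"
    using pp phi_scale[OF xi_in, of "\<eta> (\<phi> \<xi>)"] by simp
  then show ?thesis using e by auto
qed

lemma eta_phi: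
  assumes "v \<in> T"
  shows "\<eta> (\<phi> v) = 0"
proof -
  have "\<phi> (- v + \<eta> v *\<^sub>R \<xi>) = - \<phi> v + \<eta> (\<phi> v) *\<^sub>R \<xi>"
    using phi_phi[OF phi_in[OF assms]] phi_phi[OF assms] by simp
  then have "\<eta> (\<phi> v) *\<^sub>R \<xi> = 0"
    using assms by (simp add: phi_diff phi_scale closed phi_xi)
  moreover have "\<xi> \<noteq> 0"
    using eta_xi linear_map_on_0[OF linear_eta subspace] by auto
  ultimately show ?thesis by simp
qed

lemma g_xi: "v \<in> T \<Longrightarrow> g v \<xi> = \<eta> v"
  using g_phi_phi[of v \<xi>] linear_map_on_0[OF linear_g subspace, of "\<phi> v"]
  by (simp add: closed phi_xi eta_xi)

text \<open>The B-metric condition makes \<open>\<phi>\<close> symmetric, in contrast to the skew-symmetric \<open>\<phi>\<close> of an almost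
  contact metric with the usual sign.\<close>

lemma g_phi_left: "v \<in> T \<Longrightarrow> w \<in> T \<Longrightarrow> g (\<phi> v) w = g v (\<phi> w)"
  using g_phi_phi[of "\<phi> v" w] g_xi[of "\<phi> w"] g_sym[of \<xi> "\<phi> w"]
  by (simp add: phi_phi expand closed g_diff_left eta_phi)

text \<open>For nonzero \<open>v\<close> in the kernel of \<open>\<eta>\<close>, the vectors \<open>v\<close> and \<open>\<phi> v\<close> are linearly independent,
  as \<open>\<phi>\<^sup>2 v = - v\<close> excludes a real eigenvalue at \<open>v\<close>, and \<open>\<xi>\<close> is not in their span, as
  \<open>\<eta> \<xi> = 1\<close>. Three independent vectors span a space of dimension at most three.\<close>

lemma legendre_spanning:
  assumes v: "v \<in> T" "\<eta> v = 0" "v \<noteq> 0" and a: "a \<in> T"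
  obtains x y z where "a = x *\<^sub>R v + y *\<^sub>R \<phi> v + z *\<^sub>R \<xi>"
proof -
  have "\<phi> v \<notin> span {v}"
  proof
    assume "\<phi> v \<in> span {v}"
    then obtain l where l: "\<phi> v = l *\<^sub>R v" by (auto simp: span_singleton)
    have "(l * l) *\<^sub>R v = - v"
      using phi_phi[OF v(1)] v phi_scale[OF v(1), of l] by (simp add: l)
    then have "(l * l + 1) *\<^sub>R v = 0" by (simp add: scaleR_add_left)
    then show False using v(3) by (auto simp: add_nonneg_eq_0_iff)
  qed
  then have ind2: "independent {\<phi> v, v}" and neq2: "\<phi> v \<noteq> v"
    using independent_insertI[of "\<phi> v" "{v}"] v(3) span_base[of v "{v}"]
    by (auto simp: dependent_single)
  have "\<xi> \<notin> span {\<phi> v, v}"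
  proof
    assume "\<xi> \<in> span {\<phi> v, v}"
    then obtain k l where "\<xi> = k *\<^sub>R \<phi> v + l *\<^sub>R v"
      by (auto simp: span_insert algebra_simps)
    then have "\<eta> \<xi> = 0" using v by (simp add: expand closed eta_phi)
    then show False using eta_xi by simp
  qed
  then have ind3: "independent {\<xi>, \<phi> v, v}" and neq: "\<xi> \<noteq> \<phi> v" "\<xi> \<noteq> v"
    using independent_insertI[OF _ ind2] span_base[of _ "{\<phi> v, v}"] by blast+
  have "a \<in> span {\<xi>, \<phi> v, v}"
  proof (rule ccontr)
    assume n: "a \<notin> span {\<xi>, \<phi> v, v}"
    then have i: "independent {a, \<xi>, \<phi> v, v}" using independent_insertI[OF _ ind3] by simp
    obtain B where B: "finite B" "card B \<le> 3" "T \<subseteq> span B" using span by blast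
    have "{a, \<xi>, \<phi> v, v} \<subseteq> span B" using B v a closed by auto
    then have "card {a, \<xi>, \<phi> v, v} \<le> 3"
      using independent_span_bound[OF B(1) i] B(2) by (meson order_trans)
    moreover have "a \<notin> {\<xi>, \<phi> v, v}" using n span_base[of a "{\<xi>, \<phi> v, v}"] by blast
    then have "card {a, \<xi>, \<phi> v, v} = 4" using neq2 neq by auto
    ultimately show False by simp
  qed
  then obtain x y z where "a - z *\<^sub>R \<xi> - y *\<^sub>R \<phi> v = x *\<^sub>R v"
    by (auto simp: span_insert)
  then have "a = x *\<^sub>R v + y *\<^sub>R \<phi> v + z *\<^sub>R \<xi>" by (simp add: algebra_simps)
  then show ?thesis by (rule that)
qed

lemma null_legendre_products:
  assumes "v \<in> T" "\<eta> v = 0" "g v v = 0"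
  shows "g (\<phi> v) v = g v (\<phi> v)" "g (\<phi> v) (\<phi> v) = 0" "g v \<xi> = 0" "g \<xi> v = 0"
    "g (\<phi> v) \<xi> = 0" "g \<xi> (\<phi> v) = 0" "g \<xi> \<xi> = 1"
  using assms g_phi_phi[of v v] g_sym[of \<xi> v] g_sym[of \<xi> "\<phi> v"]
  by (auto simp: g_phi_left g_xi closed eta_phi eta_xi)

text \<open>If \<open>g(v, \<phi> v)\<close> vanished, then \<open>v\<close> would be orthogonal to itself, to \<open>\<phi> v\<close> and to \<open>\<xi>\<close>, hence
  to everything.\<close>

lemma null_legendre_b_nonzero:
  assumes v: "v \<in> T" "\<eta> v = 0" "v \<noteq> 0" "g v v = 0"
  shows "g v (\<phi> v) \<noteq> 0"
proof
  assume b: "g v (\<phi> v) = 0"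
  have "g v w = 0" if "w \<in> T" for w
  proof -
    obtain x y z where "w = x *\<^sub>R v + y *\<^sub>R \<phi> v + z *\<^sub>R \<xi>"
      using legendre_spanning[OF v(1-3) \<open>w \<in> T\<close>] .
    then show ?thesis using v b by (simp add: expand closed g_xi)
  qed
  then show False using g_nondegenerate v by blast
qed

text \<open>The Gram matrix of \<open>v\<close>, \<open>\<phi> v\<close>, \<open>\<xi>\<close> has the hyperbolic block with off-diagonal entry
  \<open>g(v, \<phi> v)\<close> and a \<open>1\<close>, so each coordinate of \<open>a\<close> in this basis is a single
  product divided by the matching entry.\<close>

lemma null_legendre_expansion:
  assumes v: "v \<in> T" "\<eta> v = 0" "v \<noteq> 0" "g v v = 0" and a: "a \<in> T"
  shows "a = (g a (\<phi> v) / g v (\<phi> v)) *\<^sub>R v + (g a v / g v (\<phi> v)) *\<^sub>R \<phi> v + \<eta> a *\<^sub>R \<xi>"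
proof -
  obtain x y z where e: "a = x *\<^sub>R v + y *\<^sub>R \<phi> v + z *\<^sub>R \<xi>"
    using legendre_spanning[OF v(1-3) a] .
  note p = null_legendre_products[OF v(1,2,4)] null_legendre_b_nonzero[OF v]
  have "g a (\<phi> v) = x * g v (\<phi> v)" "g a v = y * g v (\<phi> v)" "\<eta> a = z"
    unfolding e using v p by (simp_all add: expand closed eta_phi eta_xi)
  then show ?thesis using e p by simp
qed

text \<open>A unit vector orthogonal to \<open>v\<close> has no \<open>\<phi> v\<close>-component, and its \<open>\<xi>\<close>-component alone
  contributes to its length.\<close>

lemma null_legendre_unit_normal:
  assumes v: "v \<in> T" "\<eta> v = 0" "v \<noteq> 0" "g v v = 0" and w: "w \<in> T" "g v w = 0" "g w w = 1"
  obtains x where "w = x *\<^sub>R v + \<eta> w *\<^sub>R \<xi>" "(\<eta> w)\<^sup>2 = 1"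
proof -
  obtain x where x: "w = x *\<^sub>R v + \<eta> w *\<^sub>R \<xi>"
    using null_legendre_expansion[OF v w(1)] w(2) g_sym[OF v(1) w(1)] by auto
  have "g w w = g w (x *\<^sub>R v + \<eta> w *\<^sub>R \<xi>)" using x by simp
  also have "\<dots> = (\<eta> w)\<^sup>2"
    using v w g_sym[OF v(1) w(1)] by (simp add: expand closed g_xi power2_eq_square)
  finally show ?thesis using x w that by simp
qed

end


section \<open>Rules for the Levi-Civita connection\<close>

lemma levi_civita_affine: "levi_civita M A g nabla \<Longrightarrow> affine_connection M A nabla"
  by (simp add: levi_civita_def)

lemma levi_civita_metric:
  assumes "levi_civita M A g nabla" "openin M W" "vector_field A W Y" "vector_field A W Z"
    and "p \<in> W" "v \<in> tangent_space A p"
  shows "tangent_deriv A p v (\<lambda>q. g q (Y q) (Z q)) = g p (nabla p v Y) (Z p) + g p (Y p) (nabla p v Z)"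
  using assms(1)[unfolded levi_civita_def, THEN conjunct2, THEN conjunct2] assms(2-) by blast

lemma connection_cong:
  assumes "affine_connection M A nabla" "openin M W" "vector_field A W Y" "\<And>q. q \<in> W \<Longrightarrow> Y q = Z q"
    and "p \<in> W" "v \<in> tangent_space A p"
  shows "nabla p v Y = nabla p v Z"
  using assms(1)[unfolded affine_connection_def, THEN conjunct1] assms(2-) by blast

lemma connection_tangent:
  assumes "affine_connection M A nabla" "openin M W" "vector_field A W Y"
    and "p \<in> W" "v \<in> tangent_space A p"
  shows "nabla p v Y \<in> tangent_space A p"
  using assms(1)[unfolded affine_connection_def, THEN conjunct2, THEN conjunct1] assms(2-) by blast

lemma connection_add:
  assumes "affine_connection M A nabla" "openin M W" "vector_field A W Y" "vector_field A W Z"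
    and "p \<in> W" "v \<in> tangent_space A p"
  shows "nabla p v (\<lambda>q. Y q + Z q) = nabla p v Y + nabla p v Z"
  using assms(1)[unfolded affine_connection_def, THEN conjunct2, THEN conjunct2, THEN conjunct1]
    assms(2-) by blast


section \<open>Differentiation along a curve\<close>

text \<open>Relative openness of \<open>S\<close> lets derivatives within \<open>S\<close> be taken within \<open>I\<close>, and with unique limits
  within \<open>I\<close> the first member of the sequence of derivatives is the vector derivative.\<close>

lemma smooth_on_real_has_vector_derivative:
  assumes "smooth_on_real S f" "openin (top_of_set I) S" "\<And>t. t \<in> I \<Longrightarrow> at t within I \<noteq> bot"
  shows "t \<in> S \<Longrightarrow> (f has_vector_derivative vector_derivative f (at t within I)) (at t within I)"
    and "smooth_on_real S (\<lambda>s. vector_derivative f (at s within I))"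
proof -
  obtain U where U: "open U" "S = I \<inter> U" using assms(2) by (auto simp: openin_open)
  obtain F where F: "\<And>t. t \<in> S \<Longrightarrow> F 0 t = f t"
    "\<And>n t. t \<in> S \<Longrightarrow> (F n has_vector_derivative F (Suc n) t) (at t within S)"
    using assms(1) unfolding smooth_on_real_def by blast
  have at: "at t within S = at t within I" if "t \<in> S" for t
    using U that by (intro at_within_nhd[of t U]) auto
  have d: "(f has_vector_derivative F (Suc 0) t) (at t within I)" if t: "t \<in> S" for t
    using has_vector_derivative_transform[OF t _ F(2)[OF t, of 0], of f] F(1) at[OF t] by simp
  have e: "vector_derivative f (at t within I) = F (Suc 0) t" if "t \<in> S" for t
    using vector_derivative_within[OF assms(3) d[OF that]] that U by auto
  show "(f has_vector_derivative vector_derivative f (at t within I)) (at t within I)" if "t \<in> S"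
    using d[OF that] e[OF that] by simp
  show "smooth_on_real S (\<lambda>s. vector_derivative f (at s within I))"
    unfolding smooth_on_real_def by (rule exI[of _ "\<lambda>n. F (Suc n)"]) (use e F(2) in auto)
qed

lemma smooth_on_real_cong:
  "smooth_on_real S f \<Longrightarrow> (\<And>t. t \<in> S \<Longrightarrow> f t = h t) \<Longrightarrow> smooth_on_real S h"
  unfolding smooth_on_real_def by metis

locale curve_in_manifold = smooth_atlas M A
  for M :: "'a topology" and A :: "('a, 'e::euclidean_space) chart set" +
  fixes I :: "real set" and C :: "real \<Rightarrow> 'a"
  assumes curve: "smooth_curve M A I C"
begin

lemma at_within_interval_neq_bot:
  assumes "t \<in> I"
  shows "at t within I \<noteq> bot"
proof -
  have "I \<noteq> {x}" for x
    using curve by (auto simp: smooth_curve_def)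
  then have "t islimpt I"
    using curve assms by (intro connected_imp_perfect) (auto simp: smooth_curve_def is_interval_connected)
  then show ?thesis by (simp add: trivial_limit_within)
qed

lemma curve_in_topspace: "t \<in> I \<Longrightarrow> C t \<in> topspace M"
  using curve continuous_map_funspace unfolding smooth_curve_def by fastforce

lemma preimage_openin:
  assumes "openin M W"
  shows "openin (top_of_set I) {t \<in> I. C t \<in> W}"
  using curve openin_continuous_map_preimage[OF _ assms, of "top_of_set I" C]
  by (simp add: smooth_curve_def)

lemma eventually_in_open:
  assumes "openin M W" "t \<in> I" "C t \<in> W"
  shows "eventually (\<lambda>s. s \<in> I \<and> C s \<in> W) (at t within I)"
proof -
  obtain U where "open U" "{t \<in> I. C t \<in> W} = I \<inter> U"
    using preimage_openin[OF assms(1)] by (auto simp: openin_open)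
  then show ?thesis using assms unfolding eventually_at_topological by blast
qed

lemma chart_has_vector_derivative:
  assumes "t \<in> I" "c \<in> charts_at A (C t)"
  shows "((snd c \<circ> C) has_vector_derivative velocity A I C t c) (at t within I)"
proof -
  have c: "c \<in> A" "C t \<in> fst c" using assms by (auto simp: charts_at_def)
  have "smooth_on_real {t \<in> I. C t \<in> fst c} (snd c \<circ> C)"
    using curve c by (auto simp: smooth_curve_def)
  from smooth_on_real_has_vector_derivative(1)[OF this preimage_openin[OF chart_openin[OF c(1)]]]
  show ?thesis using assms c by (simp add: velocity_def at_within_interval_neq_bot)
qed

lemma vector_field_along_differentiable:
  assumes "vector_field_along A I C V" "t \<in> I" "c \<in> charts_at A (C t)"
  shows "((\<lambda>s. V s c) has_vector_derivative vector_derivative (\<lambda>s. V s c) (at t within I)) (at t within I)"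
proof -
  have c: "c \<in> A" "C t \<in> fst c" using assms by (auto simp: charts_at_def)
  have "smooth_on_real {t \<in> I. C t \<in> fst c} (\<lambda>s. V s c)"
    using assms c by (auto simp: vector_field_along_def)
  from smooth_on_real_has_vector_derivative(1)[OF this preimage_openin[OF chart_openin[OF c(1)]]]
  show ?thesis using assms c by (simp add: at_within_interval_neq_bot)
qed

lemma velocity_vector_field_along: "vector_field_along A I C (velocity A I C)"
  unfolding vector_field_along_def
proof (intro conjI ballI tangent_spaceI)
  fix t c d assume t: "t \<in> I" and cd: "c \<in> charts_at A (C t)" "d \<in> charts_at A (C t)"
  have A: "c \<in> A" "d \<in> A" "C t \<in> fst c" "C t \<in> fst d" using cd by (auto simp: charts_at_def)
  let ?D = "frechet_derivative (transition c d) (at (snd c (C t)))"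
  have "((transition c d \<circ> (snd c \<circ> C)) has_vector_derivative ?D (velocity A I C t c)) (at t within I)"
    by (rule vector_derivative_diff_chain_within[OF chart_has_vector_derivative[OF t cd(1)]])
      (simp add: has_derivative_at_withinI[OF transition_has_derivative[OF cd]])
  moreover have "eventually (\<lambda>s. (transition c d \<circ> (snd c \<circ> C)) s = (snd d \<circ> C) s) (at t within I)"
    using eventually_in_open[OF chart_openin[OF A(1)] t A(3)]
    by eventually_elim (simp add: transition_apply A)
  ultimately have "((snd d \<circ> C) has_vector_derivative ?D (velocity A I C t c)) (at t within I)"
    unfolding has_vector_derivative_def
    by (rule has_derivative_transform_eventually) (use t A in \<open>auto simp: transition_apply\<close>)
  then show "velocity A I C t d = ?D (velocity A I C t c)"
    using vector_derivative_unique_within[OF at_within_interval_neq_bot[OF t]]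
      chart_has_vector_derivative[OF t cd(2)] by blast
next
  fix c assume c: "c \<in> A"
  let ?S = "{t \<in> I. C t \<in> fst c}"
  have "smooth_on_real ?S (snd c \<circ> C)"
    using curve c by (auto simp: smooth_curve_def)
  then have "smooth_on_real ?S (\<lambda>s. vector_derivative (snd c \<circ> C) (at s within I))"
    using smooth_on_real_has_vector_derivative(2) preimage_openin[OF chart_openin[OF c]]
      at_within_interval_neq_bot by blast
  then show "smooth_on_real ?S (\<lambda>t. velocity A I C t c)"
    by (rule smooth_on_real_cong) (use c in \<open>auto simp: velocity_def charts_at_def\<close>)
qed (auto simp: velocity_def)

lemma velocity_tangent: "t \<in> I \<Longrightarrow> velocity A I C t \<in> tangent_space A (C t)"
  using velocity_vector_field_along by (auto simp: vector_field_along_def)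

lemma function_along_has_derivative:
  assumes W: "openin M W" "C t \<in> W" and t: "t \<in> I" and f: "smooth_function A W f"
  shows "((\<lambda>s. f (C s)) has_real_derivative tangent_deriv A (C t) (velocity A I C t) f) (at t within I)"
proof -
  define c where "c = (SOME c. c \<in> charts_at A (C t))"
  have c: "c \<in> charts_at A (C t)"
    unfolding c_def using chart_exists[OF curve_in_topspace[OF t]] by (rule someI_ex)
  then have A: "c \<in> A" "C t \<in> fst c" by (auto simp: charts_at_def)
  have D: "((f \<circ> chart_inv c) has_derivative frechet_derivative (f \<circ> chart_inv c) (at (snd c (C t))))
      (at (snd c (C t)))"
    by (rule smooth_on_has_derivative[of "snd c ` (W \<inter> fst c)"])
      (use f A W in \<open>auto simp: smooth_function_def\<close>)
  have "((f \<circ> chart_inv c \<circ> (snd c \<circ> C)) has_vector_derivative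
      tangent_deriv A (C t) (velocity A I C t) f) (at t within I)"
    unfolding tangent_deriv_def c_def[symmetric] Let_def
    by (rule vector_derivative_diff_chain_within[OF chart_has_vector_derivative[OF t c]])
      (unfold comp_apply[of "snd c" C], rule has_derivative_at_withinI[OF D])
  moreover have "eventually (\<lambda>s. (f \<circ> chart_inv c \<circ> (snd c \<circ> C)) s = f (C s)) (at t within I)"
    using eventually_in_open[OF chart_openin[OF A(1)] t A(2)]
    by eventually_elim (simp add: A)
  ultimately show ?thesis
    unfolding has_real_derivative_iff_has_vector_derivative has_vector_derivative_def
    by (rule has_derivative_transform_eventually) (use t A in auto)
qed

lemma metric_scale:
  assumes "pseudo_riemannian_metric M A g" "p \<in> topspace M"
    and "x \<in> tangent_space A p" "y \<in> tangent_space A p"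
  shows "g p x (r *\<^sub>R y) = r * g p x y" "g p (r *\<^sub>R y) x = r * g p y x"
  using assms subspace_scale[OF subspace_tangent_space assms(4), of r]
  by (auto simp: pseudo_riemannian_metric_def linear_map_on_def)

lemma metric_add:
  assumes "pseudo_riemannian_metric M A g" "p \<in> topspace M"
    and "x \<in> tangent_space A p" "y \<in> tangent_space A p" "z \<in> tangent_space A p"
  shows "g p x (y + z) = g p x y + g p x z" "g p (y + z) x = g p y x + g p z x"
  using assms subspace_add[OF subspace_tangent_space assms(4,5)]
  by (auto simp: pseudo_riemannian_metric_def linear_map_on_def)

lemma metric_sum:
  assumes g: "pseudo_riemannian_metric M A g" and p: "p \<in> topspace M"
    and x: "\<And>i. i \<in> J \<Longrightarrow> x i \<in> tangent_space A p" and y: "\<And>j. j \<in> K \<Longrightarrow> y j \<in> tangent_space A p"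
  shows "g p (\<Sum>i\<in>J. x i) (\<Sum>j\<in>K. y j) = (\<Sum>i\<in>J. \<Sum>j\<in>K. g p (x i) (y j))"
proof -
  note T = subspace_sum[OF subspace_tangent_space]
  have l: "linear_map_on (tangent_space A p) (g p z)" "linear_map_on (tangent_space A p) (\<lambda>y. g p y z)"
    if "z \<in> tangent_space A p" for z
    using metric_add[OF g p that] metric_scale[OF g p that] by (auto simp: linear_map_on_def)
  have "g p (\<Sum>i\<in>J. x i) (\<Sum>j\<in>K. y j) = (\<Sum>i\<in>J. g p (x i) (\<Sum>j\<in>K. y j))"
    using linear_map_on_sum[OF l(2)[OF T] subspace_tangent_space, of K y J x "\<lambda>_. 1"] x y by simp
  also have "\<dots> = (\<Sum>i\<in>J. \<Sum>j\<in>K. g p (x i) (y j))"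
    using linear_map_on_sum[OF l(1) subspace_tangent_space, of _ K y "\<lambda>_. 1"] x y by simp
  finally show ?thesis .
qed

text \<open>With \<open>P\<close> and \<open>Q\<close> expanded in vector fields of the manifold, \<open>g(P, Q)\<close> is a double sum of products
  of coefficients with functions \<open>g(Y\<^sub>i, Z\<^sub>j)\<close> of the manifold, which the metric property of the
  connection differentiates.\<close>

lemma metric_compatible_along:
  fixes Y :: "'i \<Rightarrow> 'a \<Rightarrow> ('a, 'e) tangent" and Z :: "'j \<Rightarrow> 'a \<Rightarrow> ('a, 'e) tangent"
  assumes g: "pseudo_riemannian_metric M A g" and nabla: "levi_civita M A g nabla"
    and W: "openin M W" "C t \<in> W" and t: "t \<in> I"
    and Y: "\<And>i. i \<in> J \<Longrightarrow> vector_field A W (Y i)" and Z: "\<And>j. j \<in> K \<Longrightarrow> vector_field A W (Z j)"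
    and u: "\<And>i. i \<in> J \<Longrightarrow> (u i has_real_derivative u' i) (at t within I)"
    and w: "\<And>j. j \<in> K \<Longrightarrow> (w j has_real_derivative w' j) (at t within I)"
    and P: "\<And>s. s \<in> I \<Longrightarrow> C s \<in> W \<Longrightarrow> P s = (\<Sum>i\<in>J. u i s *\<^sub>R Y i (C s))"
    and Q: "\<And>s. s \<in> I \<Longrightarrow> C s \<in> W \<Longrightarrow> Q s = (\<Sum>j\<in>K. w j s *\<^sub>R Z j (C s))"
  shows "((\<lambda>s. g (C s) (P s) (Q s)) has_real_derivative
      g (C t) (\<Sum>i\<in>J. u' i *\<^sub>R Y i (C t) + u i t *\<^sub>R nabla (C t) (velocity A I C t) (Y i)) (Q t)
    + g (C t) (P t) (\<Sum>j\<in>K. w' j *\<^sub>R Z j (C t) + w j t *\<^sub>R nabla (C t) (velocity A I C t) (Z j)))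
    (at t within I)"
proof -
  let ?v = "velocity A I C t" and ?T = "tangent_space A (C t)"
  let ?DY = "\<lambda>i. nabla (C t) ?v (Y i)" and ?DZ = "\<lambda>j. nabla (C t) ?v (Z j)"
  have topW: "C s \<in> topspace M" if "C s \<in> W" for s
    using that openin_subset[OF W(1)] by auto
  have TY: "Y i p \<in> tangent_space A p" if "i \<in> J" "p \<in> W" for i p
    using Y that by (auto simp: vector_field_def)
  have TZ: "Z j p \<in> tangent_space A p" if "j \<in> K" "p \<in> W" for j p
    using Z that by (auto simp: vector_field_def)
  note v = velocity_tangent[OF t] and T = subspace_add[OF subspace_tangent_space]
    subspace_scale[OF subspace_tangent_space]
  have TDY: "?DY i \<in> ?T" if "i \<in> J" for i
    using connection_tangent[OF levi_civita_affine[OF nabla] W(1) Y[OF that] W(2) v] .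
  have TDZ: "?DZ j \<in> ?T" if "j \<in> K" for j
    using connection_tangent[OF levi_civita_affine[OF nabla] W(1) Z[OF that] W(2) v] .
  let ?G = "\<lambda>i j s. g (C s) (Y i (C s)) (Z j (C s))"
  have G: "(?G i j has_real_derivative
      g (C t) (?DY i) (Z j (C t)) + g (C t) (Y i (C t)) (?DZ j)) (at t within I)"
    if "i \<in> J" "j \<in> K" for i j
  proof -
    have "smooth_function A W (\<lambda>p. g p (Y i p) (Z j p))"
      using g W(1) Y[OF that(1)] Z[OF that(2)] unfolding pseudo_riemannian_metric_def by simp
    from function_along_has_derivative[OF W t this]
    have "(?G i j has_real_derivative tangent_deriv A (C t) ?v (\<lambda>p. g p (Y i p) (Z j p))) (at t within I)" .
    moreover have "tangent_deriv A (C t) ?v (\<lambda>p. g p (Y i p) (Z j p))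
        = g (C t) (?DY i) (Z j (C t)) + g (C t) (Y i (C t)) (?DZ j)"
      using levi_civita_metric[OF nabla W(1) Y[OF that(1)] Z[OF that(2)] W(2) v] .
    ultimately show ?thesis by simp
  qed
  let ?e = "\<lambda>s. \<Sum>i\<in>J. \<Sum>j\<in>K. u i s * (w j s * ?G i j s)"
  note sums = metric_sum[OF g] and bil = metric_add[OF g] metric_scale[OF g]
  have E: "g (C s) (P s) (Q s) = ?e s" if "s \<in> I" "C s \<in> W" for s
    using that by (simp add: P Q sums bil topW TY TZ T mult.left_commute)
  have D: "(?e has_real_derivative (\<Sum>i\<in>J. \<Sum>j\<in>K.
        u' i * (w j t * ?G i j t) + (w' j * ?G i j t
          + (g (C t) (?DY i) (Z j (C t)) + g (C t) (Y i (C t)) (?DZ j)) * w j t) * u i t))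
      (at t within I)"
    using u w G by (intro DERIV_sum DERIV_mult)
  have eq: "(\<Sum>i\<in>J. \<Sum>j\<in>K.
        u' i * (w j t * ?G i j t) + (w' j * ?G i j t
          + (g (C t) (?DY i) (Z j (C t)) + g (C t) (Y i (C t)) (?DZ j)) * w j t) * u i t)
      = g (C t) (\<Sum>i\<in>J. u' i *\<^sub>R Y i (C t) + u i t *\<^sub>R ?DY i) (Q t)
      + g (C t) (P t) (\<Sum>j\<in>K. w' j *\<^sub>R Z j (C t) + w j t *\<^sub>R ?DZ j)"
    using TY TZ TDY TDZ W(2)
    by (simp add: P[OF t W(2)] Q[OF t W(2)] sums[OF topW[OF W(2)]] bil[OF topW[OF W(2)]] T
        distrib_left distrib_right mult_ac add_ac) (simp add: sum.distrib add_ac)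
  have ev: "eventually (\<lambda>s. g (C s) (P s) (Q s) = ?e s) (at t within I)"
    using eventually_in_open[OF W(1) t W(2)] by eventually_elim (simp add: E)
  show ?thesis
    using D unfolding eq has_field_derivative_cong_eventually[OF ev E[OF t W(2)]] .
qed

end


section \<open>Legendre null curves in Sasaki-like manifolds\<close>

lemma (in smooth_atlas) contact_B_space_tangent:
  assumes "DIM('e) = 3" "almost_contact_B_metric M A \<phi> \<xi> \<eta> g" "p \<in> topspace M"
  shows "contact_B_space (tangent_space A p) (\<phi> p) (\<xi> p) (\<eta> p) (g p)"
proof
  obtain c where c: "c \<in> charts_at A p" using chart_exists[OF assms(3)] by blast
  let ?B = "(\<lambda>i. coord_field A c i p) ` Basis"
  have "v \<in> span ?B" if "v \<in> tangent_space A p" for v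
    by (subst tangent_eq_sum[OF c that]) (intro span_sum span_scale span_base imageI)
  moreover have "card ?B \<le> 3" using card_image_le[of Basis] assms(1) by (metis finite_Basis)
  ultimately show "\<exists>B. finite B \<and> card B \<le> 3 \<and> tangent_space A p \<subseteq> span B"
    by (intro exI[of _ ?B]) auto
next
  show "subspace (tangent_space A p)" by (rule subspace_tangent_space)
  have m: "pseudo_riemannian_metric M A g" and "vector_field A (topspace M) \<xi>"
    using assms(2) by (simp_all add: almost_contact_B_metric_def)
  then show "\<xi> p \<in> tangent_space A p" using assms(3) by (simp add: vector_field_def)
  show "linear_map_on (tangent_space A p) (\<phi> p)" "linear_map_on (tangent_space A p) (\<eta> p)"
    "\<eta> p (\<xi> p) = 1"
    using assms(2,3) by (simp_all add: almost_contact_B_metric_def)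
  fix v assume v: "v \<in> tangent_space A p"
  have "\<phi> p ` tangent_space A p \<subseteq> tangent_space A p"
    using assms(2,3) by (simp add: almost_contact_B_metric_def)
  then show "\<phi> p v \<in> tangent_space A p" using v by auto
  show "\<phi> p (\<phi> p v) = - v + \<eta> p v *\<^sub>R \<xi> p"
    using assms(2)[unfolded almost_contact_B_metric_def] assms(3) v by blast
  show "linear_map_on (tangent_space A p) (g p v)"
    using m assms(3) v by (simp add: pseudo_riemannian_metric_def)
  show "v = 0" if "\<And>w. w \<in> tangent_space A p \<Longrightarrow> g p v w = 0"
    using m assms(3) v that by (simp add: pseudo_riemannian_metric_def)
  fix w assume w: "w \<in> tangent_space A p"
  show "g p v w = g p w v"
    using m assms(3) v w unfolding pseudo_riemannian_metric_def by blast
  show "g p (\<phi> p v) (\<phi> p w) = - g p v w + \<eta> p v * \<eta> p w"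
    using assms(2)[unfolded almost_contact_B_metric_def] assms(3) v w by blast
qed

locale legendre_null_curve = curve_in_manifold M A I C
  for M :: "'a topology" and A :: "('a, 'e::euclidean_space) chart set" and I C +
  fixes \<phi> :: "'a \<Rightarrow> ('a, 'e) tangent \<Rightarrow> ('a, 'e) tangent" and \<xi> :: "'a \<Rightarrow> ('a, 'e) tangent"
    and \<eta> :: "'a \<Rightarrow> ('a, 'e) tangent \<Rightarrow> real"
    and g :: "'a \<Rightarrow> ('a, 'e) tangent \<Rightarrow> ('a, 'e) tangent \<Rightarrow> real"
    and nabla :: "('a, 'e) connection"
  assumes dim: "DIM('e) = 3"
    and B_metric: "almost_contact_B_metric M A \<phi> \<xi> \<eta> g"
    and nabla: "levi_civita M A g nabla"
    and sasaki: "sasaki_like M A \<phi> \<xi> \<eta> g nabla"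
    and null: "null_curve M A g I C"
    and legendre: "legendre_curve M A \<eta> I C"
begin

abbreviation v where "v \<equiv> velocity A I C"

lemmas B_space = contact_B_space_tangent[OF dim B_metric]

lemma metric: "pseudo_riemannian_metric M A g"
  using B_metric by (simp add: almost_contact_B_metric_def)

lemma velocity_null: "t \<in> I \<Longrightarrow> g (C t) (v t) (v t) = 0"
  and velocity_nonzero: "t \<in> I \<Longrightarrow> v t \<noteq> 0"
  and velocity_legendre: "t \<in> I \<Longrightarrow> \<eta> (C t) (v t) = 0"
  using null legendre by (auto simp: null_curve_def legendre_curve_def)

lemma phi_vector_field: "openin M W \<Longrightarrow> vector_field A W X \<Longrightarrow> vector_field A W (\<lambda>p. \<phi> p (X p))"
  using B_metric unfolding almost_contact_B_metric_def by meson

lemma xi_vector_field: "openin M W \<Longrightarrow> vector_field A W \<xi>"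
  using B_metric vector_field_subset[of "topspace M" \<xi> W] openin_subset[of M W]
  by (simp add: almost_contact_B_metric_def)

text \<open>To apply the Sasaki-like condition, which concerns vector fields, to a single vector \<open>x\<close>, extend
  \<open>x\<close> by constant components in a chart.\<close>

lemma nabla_phi:
  assumes "c \<in> charts_at A p" "x \<in> tangent_space A p" "vector_field A (fst c) Y"
  shows "nabla p x (\<lambda>q. \<phi> q (Y q)) = \<phi> p (nabla p x Y) - g p x (Y p) *\<^sub>R \<xi> p - \<eta> p (Y p) *\<^sub>R x
    + (2 * \<eta> p x * \<eta> p (Y p)) *\<^sub>R \<xi> p"
proof -
  have c: "c \<in> A" "p \<in> fst c" using assms(1) by (auto simp: charts_at_def)
  have "nabla p (coord_field A c (x c) p) (\<lambda>q. \<phi> q (Y q)) - \<phi> p (nabla p (coord_field A c (x c) p) Y)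
      = - (g p (coord_field A c (x c) p) (Y p) *\<^sub>R \<xi> p) - \<eta> p (Y p) *\<^sub>R coord_field A c (x c) p
        + (2 * \<eta> p (coord_field A c (x c) p) * \<eta> p (Y p)) *\<^sub>R \<xi> p"
    using sasaki[unfolded sasaki_like_def, rule_format, of "fst c" "coord_field A c (x c)" Y p]
      chart_openin[OF c(1)] vector_field_coord[OF c(1)] assms(3) c(2) by simp
  then show ?thesis
    unfolding tangent_eq_coord_field[OF assms(1,2)] by (simp add: algebra_simps)
qed

text \<open>Applying the Sasaki-like condition to \<open>\<phi> \<xi> = 0\<close> determines \<open>\<phi> (\<nabla>\<^sub>x \<xi>)\<close>, hence \<open>\<nabla>\<^sub>x \<xi>\<close> up to
  a multiple of \<open>\<xi>\<close>; this multiple vanishes as \<open>\<xi>\<close> has constant length.\<close>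

lemma nabla_xi:
  assumes p: "p \<in> topspace M" and x: "x \<in> tangent_space A p"
  shows "nabla p x \<xi> = - \<phi> p x"
proof -
  interpret contact_B_space "tangent_space A p" "\<phi> p" "\<xi> p" "\<eta> p" "g p" by (rule B_space[OF p])
  obtain c where c: "c \<in> charts_at A p" using chart_exists[OF p] by blast
  then have cA: "c \<in> A" "p \<in> fst c" by (auto simp: charts_at_def)
  note W = chart_openin[OF cA(1)] and aff = levi_civita_affine[OF nabla]
  note xi = xi_vector_field[OF W] and phi_xi_field = phi_vector_field[OF W xi_vector_field[OF W]]
  have z: "\<phi> q (\<xi> q) = 0" if "q \<in> fst c" for q
    using contact_B_space.phi_xi[OF B_space[of q]] that openin_subset[OF W] by auto
  have D: "nabla p x \<xi> \<in> tangent_space A p"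
    using connection_tangent[OF aff W xi cA(2) x] .
  \<comment> \<open>The field \<open>\<phi> \<xi> = 0\<close> equals its own double, hence so does its derivative.\<close>
  have "nabla p x (\<lambda>q. \<phi> q (\<xi> q)) = nabla p x (\<lambda>q. \<phi> q (\<xi> q) + \<phi> q (\<xi> q))"
    by (rule connection_cong[OF aff W phi_xi_field _ cA(2) x]) (simp add: z)
  also have "\<dots> = nabla p x (\<lambda>q. \<phi> q (\<xi> q)) + nabla p x (\<lambda>q. \<phi> q (\<xi> q))"
    using connection_add[OF aff W phi_xi_field phi_xi_field cA(2) x] .
  finally have "nabla p x (\<lambda>q. \<phi> q (\<xi> q)) = 0" by simp
  then have "0 = \<phi> p (nabla p x \<xi>) - \<eta> p x *\<^sub>R \<xi> p - x + (\<eta> p x + \<eta> p x) *\<^sub>R \<xi> p"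
    using nabla_phi[OF c x xi] g_xi[OF x] eta_xi by simp
  then have phi_D: "\<phi> p (nabla p x \<xi>) = x - \<eta> p x *\<^sub>R \<xi> p"
    unfolding scaleR_add_left by (simp add: algebra_simps)
  have "tangent_deriv A p x (\<lambda>q. g q (\<xi> q) (\<xi> q)) = 0"
  proof (rule tangent_deriv_locally_const[OF W cA(2)])
    fix q assume "q \<in> fst c"
    then interpret q: contact_B_space "tangent_space A q" "\<phi> q" "\<xi> q" "\<eta> q" "g q"
      using B_space[of q] openin_subset[OF W] by auto
    show "g q (\<xi> q) (\<xi> q) = 1" using q.g_xi[OF q.xi_in] q.eta_xi by simp
  qed
  then have "\<eta> p (nabla p x \<xi>) = 0"
    using levi_civita_metric[OF nabla W xi xi cA(2) x] g_xi[OF D] g_sym[OF D xi_in] by simp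
  then have "- nabla p x \<xi> = \<phi> p (x - \<eta> p x *\<^sub>R \<xi> p)"
    using phi_phi[OF D] phi_D by simp
  also have "\<dots> = \<phi> p x"
    using x by (simp add: phi_diff phi_scale closed phi_xi)
  finally show ?thesis by (simp add: minus_equation_iff)
qed

text \<open>The covariant derivative along a curve is a family of components, each computed with the
  coordinate frame of its own chart. For one chart \<open>c\<close> this is the tangent vector that has the
  right component in \<open>c\<close>.\<close>

definition chart_covariant_deriv ::
  "('a, 'e) chart \<Rightarrow> (real \<Rightarrow> ('a, 'e) tangent) \<Rightarrow> real \<Rightarrow> ('a, 'e) tangent"
  where "chart_covariant_deriv c V t =
    (\<Sum>i\<in>Basis. (vector_derivative (\<lambda>s. V s c) (at t within I) \<bullet> i) *\<^sub>R coord_field A c i (C t)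
      + (V t c \<bullet> i) *\<^sub>R nabla (C t) (v t) (coord_field A c i))"

context
  fixes t c
  assumes t: "t \<in> I" and c: "c \<in> charts_at A (C t)"
begin

interpretation contact_B_space "tangent_space A (C t)" "\<phi> (C t)" "\<xi> (C t)" "\<eta> (C t)" "g (C t)"
  by (rule B_space[OF curve_in_topspace[OF t]])

lemma chart_at: "c \<in> A" "C t \<in> fst c"
  using c by (auto simp: charts_at_def)

lemma chart_covariant_deriv_apply:
  "chart_covariant_deriv c V t c = covariant_deriv_along A nabla I C V t c"
  by (simp add: chart_covariant_deriv_def covariant_deriv_along_def c sum_fun_apply sum.distrib
      euclidean_representation)

lemma nabla_coord_tangent: "nabla (C t) (v t) (coord_field A c i) \<in> tangent_space A (C t)"
  using connection_tangent[OF levi_civita_affine[OF nabla] chart_openin vector_field_coord]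
    chart_at velocity_tangent[OF t] by blast

lemma chart_covariant_deriv_tangent: "chart_covariant_deriv c V t \<in> tangent_space A (C t)"
  unfolding chart_covariant_deriv_def
  by (intro subspace_sum[OF subspace] closed nabla_coord_tangent coord_field_tangent c)

lemma component_has_derivative:
  assumes "vector_field_along A I C V"
  shows "((\<lambda>s. V s c \<bullet> i) has_real_derivative vector_derivative (\<lambda>s. V s c) (at t within I) \<bullet> i)
    (at t within I)"
  using has_derivative_inner_left[OF vector_field_along_differentiable[OF assms t c,
      unfolded has_vector_derivative_def], of i]
  by (simp add: has_real_derivative_iff_has_vector_derivative has_vector_derivative_def)

lemma vector_field_along_eq_sum:
  assumes "vector_field_along A I C V" "s \<in> I" "C s \<in> fst c"
  shows "V s = (\<Sum>i\<in>Basis. (V s c \<bullet> i) *\<^sub>R coord_field A c i (C s))"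
  using assms chart_at by (intro tangent_eq_sum) (auto simp: charts_at_def vector_field_along_def)

lemmas velocity_eq_sum = vector_field_along_eq_sum[OF velocity_vector_field_along]

text \<open>The product rule in which one factor is expanded in the coordinate frame of \<open>c\<close>; the other factor
  will be expanded in the frame, in its image under \<open>\<phi>\<close>, or in \<open>\<xi>\<close> alone.\<close>

lemma metric_along_has_derivative:
  assumes V: "vector_field_along A I C V"
    and Z: "\<And>j. j \<in> K \<Longrightarrow> vector_field A (fst c) (Z j)"
    and w: "\<And>j. j \<in> K \<Longrightarrow> (w j has_real_derivative w' j) (at t within I)"
    and Q: "\<And>s. s \<in> I \<Longrightarrow> C s \<in> fst c \<Longrightarrow> Q s = (\<Sum>j\<in>K. w j s *\<^sub>R Z j (C s))"
  shows "((\<lambda>s. g (C s) (V s) (Q s)) has_real_derivative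
      g (C t) (chart_covariant_deriv c V t) (Q t)
      + g (C t) (V t) (\<Sum>j\<in>K. w' j *\<^sub>R Z j (C t) + w j t *\<^sub>R nabla (C t) (v t) (Z j)))
      (at t within I)"
  unfolding chart_covariant_deriv_def
  by (rule metric_compatible_along[OF metric nabla chart_openin[OF chart_at(1)] chart_at(2) t,
        where Y = "coord_field A c" and u = "\<lambda>i s. V s c \<bullet> i"])
    (rule vector_field_coord[OF chart_at(1)] Z component_has_derivative[OF V] w
      vector_field_along_eq_sum[OF V] Q | assumption)+

lemma velocity_metric_has_derivative:
  "((\<lambda>s. g (C s) (v s) (v s)) has_real_derivative
    2 * g (C t) (v t) (chart_covariant_deriv c v t)) (at t within I)"
proof -
  have "((\<lambda>s. g (C s) (v s) (v s)) has_real_derivative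
      g (C t) (chart_covariant_deriv c v t) (v t) + g (C t) (v t) (chart_covariant_deriv c v t))
      (at t within I)"
    unfolding chart_covariant_deriv_def[of c v t, THEN arg_cong[where f = "g (C t) (v t)"]]
    by (rule metric_along_has_derivative[where w = "\<lambda>i s. v s c \<bullet> i"])
      (rule velocity_vector_field_along vector_field_coord[OF chart_at(1)]
        component_has_derivative[OF velocity_vector_field_along] velocity_eq_sum | assumption)+
  then show ?thesis
    using g_sym[OF chart_covariant_deriv_tangent[of v] velocity_tangent[OF t]] by simp
qed

text \<open>Since \<open>\<eta>\<close> is the pairing with \<open>\<xi>\<close>, this is the product rule together with
  \<open>\<nabla>\<^sub>v \<xi> = - \<phi> v\<close>. Beyond its use for the velocity, it shows that \<open>\<eta>\<close> of a frame field is
  continuous in the parameter.\<close>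

lemma eta_has_derivative:
  assumes V: "vector_field_along A I C V"
  shows "((\<lambda>s. \<eta> (C s) (V s)) has_real_derivative
    \<eta> (C t) (chart_covariant_deriv c V t) - g (C t) (V t) (\<phi> (C t) (v t))) (at t within I)"
proof -
  have eta: "g (C s) (V s) (\<xi> (C s)) = \<eta> (C s) (V s)" if "s \<in> I" for s
    using contact_B_space.g_xi[OF B_space[OF curve_in_topspace[OF that]]] V that
    by (auto simp: vector_field_along_def)
  have "((\<lambda>s. g (C s) (V s) (\<xi> (C s))) has_real_derivative
      g (C t) (chart_covariant_deriv c V t) (\<xi> (C t))
      + g (C t) (V t) (\<Sum>j\<in>{()}. 0 *\<^sub>R \<xi> (C t) + 1 *\<^sub>R nabla (C t) (v t) \<xi>)) (at t within I)"
    by (rule metric_along_has_derivative[where Z = "\<lambda>_. \<xi>" and w = "\<lambda>_ _. 1" and w' = "\<lambda>_. 0"])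
      (auto intro: V chart_at xi_vector_field chart_openin)
  moreover have "V t \<in> tangent_space A (C t)"
    using V t by (auto simp: vector_field_along_def)
  ultimately have D: "((\<lambda>s. g (C s) (V s) (\<xi> (C s))) has_real_derivative
      \<eta> (C t) (chart_covariant_deriv c V t) - g (C t) (V t) (\<phi> (C t) (v t))) (at t within I)"
    using nabla_xi[OF curve_in_topspace[OF t] velocity_tangent[OF t]] velocity_tangent[OF t]
    by (simp add: g_xi chart_covariant_deriv_tangent g_minus_right closed)
  show ?thesis
    by (rule has_field_derivative_transform_within[OF D zero_less_one t]) (rule eta)
qed

text \<open>Along a Legendre null curve all three correction terms of the Sasaki-like condition vanish
  at the velocity, so that \<open>\<phi>\<close> can be treated as if it were parallel.\<close>

lemma phi_velocity_deriv:
  "(\<Sum>i\<in>Basis. (vector_derivative (\<lambda>s. v s c) (at t within I) \<bullet> i) *\<^sub>R \<phi> (C t) (coord_field A c i (C t))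
      + (v t c \<bullet> i) *\<^sub>R nabla (C t) (v t) (\<lambda>q. \<phi> q (coord_field A c i q)))
    = \<phi> (C t) (chart_covariant_deriv c v t)" (is "(\<Sum>i\<in>Basis. ?l i) = _")
proof -
  let ?E = "\<lambda>i. coord_field A c i (C t)" and ?a = "\<lambda>i. v t c \<bullet> i"
  let ?d = "\<lambda>i. (vector_derivative (\<lambda>s. v s c) (at t within I) \<bullet> i) *\<^sub>R ?E i
    + ?a i *\<^sub>R nabla (C t) (v t) (coord_field A c i)"
  note E = coord_field_tangent[OF c] and v = velocity_tangent[OF t]
  have d: "?d i \<in> tangent_space A (C t)" for i
    by (intro closed E nabla_coord_tangent)
  have l: "?l i = \<phi> (C t) (?d i) - (?a i *\<^sub>R g (C t) (v t) (?E i)) *\<^sub>R \<xi> (C t)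
      - (?a i *\<^sub>R \<eta> (C t) (?E i)) *\<^sub>R v t" for i
    using nabla_phi[OF c v vector_field_coord[OF chart_at(1)], of i] velocity_legendre[OF t]
    by (simp add: phi_add phi_scale E closed nabla_coord_tangent scaleR_diff_right)
  have "(\<Sum>i\<in>Basis. ?l i) = (\<Sum>i\<in>Basis. 1 *\<^sub>R \<phi> (C t) (?d i))
      - (\<Sum>i\<in>Basis. ?a i *\<^sub>R g (C t) (v t) (?E i)) *\<^sub>R \<xi> (C t)
      - (\<Sum>i\<in>Basis. ?a i *\<^sub>R \<eta> (C t) (?E i)) *\<^sub>R v t"
    by (simp only: l sum_subtractf scaleR_sum_left scaleR_one)
  also have "(\<Sum>i\<in>Basis. 1 *\<^sub>R \<phi> (C t) (?d i)) = \<phi> (C t) (chart_covariant_deriv c v t)"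
    using linear_map_on_sum[OF linear_phi subspace, where J = Basis and x = ?d and r = "\<lambda>_. 1", OF d]
    by (simp add: chart_covariant_deriv_def)
  also have "(\<Sum>i\<in>Basis. ?a i *\<^sub>R g (C t) (v t) (?E i)) = 0"
    using linear_map_on_sum[OF linear_g[OF v] subspace, where J = Basis and x = ?E and r = ?a, OF E]
      velocity_eq_sum[OF t chart_at(2)] velocity_null[OF t] by simp
  also have "(\<Sum>i\<in>Basis. ?a i *\<^sub>R \<eta> (C t) (?E i)) = 0"
    using linear_map_on_sum[OF linear_eta subspace, where J = Basis and x = ?E and r = ?a, OF E]
      velocity_eq_sum[OF t chart_at(2)] velocity_legendre[OF t] by simp
  finally show ?thesis by (simp only: scaleR_zero_left diff_zero)
qed

lemma b_has_derivative:
  "((\<lambda>s. g (C s) (v s) (\<phi> (C s) (v s))) has_real_derivative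
    2 * g (C t) (chart_covariant_deriv c v t) (\<phi> (C t) (v t))) (at t within I)"
proof -
  note v = velocity_tangent[OF t] and a = chart_covariant_deriv_tangent[of v]
  have phi_sum: "\<phi> (C s) (v s) = (\<Sum>i\<in>Basis. (v s c \<bullet> i) *\<^sub>R \<phi> (C s) (coord_field A c i (C s)))"
    if s: "s \<in> I" "C s \<in> fst c" for s
  proof -
    interpret s: contact_B_space "tangent_space A (C s)" "\<phi> (C s)" "\<xi> (C s)" "\<eta> (C s)" "g (C s)"
      by (rule B_space[OF curve_in_topspace[OF s(1)]])
    have "c \<in> charts_at A (C s)" using s chart_at by (auto simp: charts_at_def)
    then show ?thesis
      using linear_map_on_sum[OF s.linear_phi s.subspace, where J = Basis and r = "\<lambda>i. v s c \<bullet> i"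
          and x = "\<lambda>i. coord_field A c i (C s)", OF coord_field_tangent] velocity_eq_sum[OF s] by simp
  qed
  have "((\<lambda>s. g (C s) (v s) (\<phi> (C s) (v s))) has_real_derivative
      g (C t) (chart_covariant_deriv c v t) (\<phi> (C t) (v t))
      + g (C t) (v t) (\<phi> (C t) (chart_covariant_deriv c v t))) (at t within I)"
    unfolding phi_velocity_deriv[symmetric]
    by (rule metric_along_has_derivative[where w = "\<lambda>i s. v s c \<bullet> i"
          and Z = "\<lambda>i q. \<phi> q (coord_field A c i q)"])
      (rule velocity_vector_field_along phi_vector_field[OF chart_openin[OF chart_at(1)]]
        vector_field_coord[OF chart_at(1)]
        component_has_derivative[OF velocity_vector_field_along] phi_sum | assumption)+
  moreover have "g (C t) (v t) (\<phi> (C t) (chart_covariant_deriv c v t))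
      = g (C t) (chart_covariant_deriv c v t) (\<phi> (C t) (v t))"
    using g_phi_left[OF v a] g_sym[OF a phi_in[OF v]] by simp
  ultimately show ?thesis by simp
qed

text \<open>Differentiating \<open>g(v, v) = 0\<close>, \<open>\<eta>(v) = 0\<close> and \<open>g(v, \<phi> v) = b\<close> gives the products of the
  acceleration with \<open>v\<close>, \<open>\<xi>\<close> and \<open>\<phi> v\<close>: they are \<open>0\<close>, \<open>b\<close> and half the derivative of \<open>b\<close>.\<close>

lemma chart_acceleration_eq:
  "chart_covariant_deriv c v t = g (C t) (v t) (\<phi> (C t) (v t)) *\<^sub>R \<xi> (C t)
    + (vector_derivative (\<lambda>s. g (C s) (v s) (\<phi> (C s) (v s))) (at t within I)
      / (2 * g (C t) (v t) (\<phi> (C t) (v t)))) *\<^sub>R v t"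
proof -
  note v = velocity_tangent[OF t] and a = chart_covariant_deriv_tangent[of v]
  have const: "D = 0" if "(f has_real_derivative D) (at t within I)" "\<And>s. s \<in> I \<Longrightarrow> f s = (0::real)" for f D
  proof -
    have "((\<lambda>_. 0) has_real_derivative D) (at t within I)"
      by (rule has_field_derivative_transform_within[OF that(1) zero_less_one t]) (rule that(2))
    then show ?thesis
      using vector_derivative_unique_within[OF at_within_interval_neq_bot[OF t]]
      by (metis has_real_derivative_iff_has_vector_derivative has_vector_derivative_const)
  qed
  have "g (C t) (v t) (chart_covariant_deriv c v t) = 0"
    using const[OF velocity_metric_has_derivative] velocity_null by simp
  then have 1: "g (C t) (chart_covariant_deriv c v t) (v t) = 0"
    using g_sym[OF a v] by simp
  have 2: "\<eta> (C t) (chart_covariant_deriv c v t) = g (C t) (v t) (\<phi> (C t) (v t))"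
    using const[OF eta_has_derivative[OF velocity_vector_field_along]] velocity_legendre by simp
  have 3: "vector_derivative (\<lambda>s. g (C s) (v s) (\<phi> (C s) (v s))) (at t within I)
      = 2 * g (C t) (chart_covariant_deriv c v t) (\<phi> (C t) (v t))"
    by (rule vector_derivative_within[OF at_within_interval_neq_bot[OF t]])
      (use b_has_derivative in \<open>simp add: has_real_derivative_iff_has_vector_derivative\<close>)
  show ?thesis
    using null_legendre_expansion[OF v velocity_legendre[OF t] velocity_nonzero[OF t] velocity_null[OF t] a]
    unfolding 1 2 3 by (simp add: add.commute)
qed

end

text \<open>The right-hand side of \<open>chart_acceleration_eq\<close> is the same for all charts, so the components
  of the covariant derivative in the various charts are those of a single tangent vector.\<close>

lemma acceleration_eq:
  assumes t: "t \<in> I"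
  shows "covariant_deriv_along A nabla I C v t = g (C t) (v t) (\<phi> (C t) (v t)) *\<^sub>R \<xi> (C t)
    + (vector_derivative (\<lambda>s. g (C s) (v s) (\<phi> (C s) (v s))) (at t within I)
      / (2 * g (C t) (v t) (\<phi> (C t) (v t)))) *\<^sub>R v t" (is "_ = ?r")
proof
  fix c
  interpret contact_B_space "tangent_space A (C t)" "\<phi> (C t)" "\<xi> (C t)" "\<eta> (C t)" "g (C t)"
    by (rule B_space[OF curve_in_topspace[OF t]])
  show "covariant_deriv_along A nabla I C v t c = ?r c"
  proof (cases "c \<in> charts_at A (C t)")
    case True
    then show ?thesis
      using chart_covariant_deriv_apply[OF t True] chart_acceleration_eq[OF t True] by metis
  next
    case False
    then show ?thesis
      using tangent_space_outside[OF velocity_tangent[OF t] False] tangent_space_outside[OF xi_in False]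
      by (simp add: covariant_deriv_along_def)
  qed
qed

lemma frenet_normal:
  assumes frame: "general_frenet_frame A g I C N W" and t: "t \<in> I"
  obtains x where "W t = x *\<^sub>R v t + \<eta> (C t) (W t) *\<^sub>R \<xi> (C t)" "(\<eta> (C t) (W t))\<^sup>2 = 1"
proof -
  interpret contact_B_space "tangent_space A (C t)" "\<phi> (C t)" "\<xi> (C t)" "\<eta> (C t)" "g (C t)"
    by (rule B_space[OF curve_in_topspace[OF t]])
  have "W t \<in> tangent_space A (C t)" "g (C t) (v t) (W t) = 0" "g (C t) (W t) (W t) = 1"
    using frame t by (auto simp: general_frenet_frame_def vector_field_along_def)
  from null_legendre_unit_normal[OF velocity_tangent[OF t] velocity_legendre[OF t]
      velocity_nonzero[OF t] velocity_null[OF t] this] that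
  show ?thesis by blast
qed

text \<open>Write \<open>W = x v + \<eta>(W) \<xi>\<close>. Substituting \<open>\<xi> = \<eta>(W) (W - x v)\<close> into the formula for the
  acceleration gives \<open>k\<^sub>1 = \<eta>(W) b\<close>, and applying \<open>\<eta>\<close> shows that no other coefficient of \<open>W\<close> is
  possible.\<close>

lemma frenet_k1_eq:
  assumes frame: "general_frenet_frame A g I C N W" and t: "t \<in> I"
  shows "frenet_k1 A nabla I C W t = \<eta> (C t) (W t) * g (C t) (v t) (\<phi> (C t) (v t))"
proof -
  interpret contact_B_space "tangent_space A (C t)" "\<phi> (C t)" "\<xi> (C t)" "\<eta> (C t)" "g (C t)"
    by (rule B_space[OF curve_in_topspace[OF t]])
  let ?z = "\<eta> (C t) (W t)" and ?b = "g (C t) (v t) (\<phi> (C t) (v t))"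
  obtain x where x: "W t = x *\<^sub>R v t + ?z *\<^sub>R \<xi> (C t)" and z: "?z\<^sup>2 = 1"
    using frenet_normal[OF frame t] .
  have W: "W t \<in> tangent_space A (C t)"
    using frame t by (auto simp: general_frenet_frame_def vector_field_along_def)
  obtain h where h: "covariant_deriv_along A nabla I C v t = ?b *\<^sub>R \<xi> (C t) + h *\<^sub>R v t"
    using acceleration_eq[OF t] by blast
  have zW: "?z *\<^sub>R W t = (?z * x) *\<^sub>R v t + ?z\<^sup>2 *\<^sub>R \<xi> (C t)"
    by (subst x) (simp add: scaleR_add_right power2_eq_square)
  have "?b *\<^sub>R \<xi> (C t) = ?b *\<^sub>R (?z *\<^sub>R W t - (?z * x) *\<^sub>R v t)"
    unfolding zW z by simp
  then have e: "covariant_deriv_along A nabla I C v t = (h - ?b * ?z * x) *\<^sub>R v t + (?z * ?b) *\<^sub>R W t"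
    unfolding h by (simp add: algebra_simps)
  have eta: "\<eta> (C t) (r *\<^sub>R v t + k *\<^sub>R W t) = k * ?z" for r k
    using velocity_tangent[OF t] W velocity_legendre[OF t] by (simp add: eta_add eta_scale closed)
  have "k = ?z * ?b"
    if k: "\<exists>r. covariant_deriv_along A nabla I C v t = r *\<^sub>R v t + k *\<^sub>R W t" for k
  proof -
    have "k * ?z = ?z * ?b * ?z" using k e eta by metis
    then show ?thesis using z by auto
  qed
  then show ?thesis
    unfolding frenet_k1_def using e by (intro the_equality) blast+
qed

text \<open>The sign \<open>\<eta>(W)\<close> cannot jump, as it is continuous on an interval.\<close>

lemma eta_normal_constant:
  assumes frame: "general_frenet_frame A g I C N W"
  shows "\<exists>\<epsilon>\<in>{1, -1}. \<forall>t\<in>I. \<eta> (C t) (W t) = \<epsilon>"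
proof -
  have W: "vector_field_along A I C W" using frame by (simp add: general_frenet_frame_def)
  have "continuous_on I (\<lambda>t. \<eta> (C t) (W t))"
    unfolding continuous_on_eq_continuous_within
  proof
    fix t assume t: "t \<in> I"
    obtain c where "c \<in> charts_at A (C t)" using chart_exists[OF curve_in_topspace[OF t]] by blast
    from DERIV_continuous[OF eta_has_derivative[OF t this W]]
    show "continuous (at t within I) (\<lambda>t. \<eta> (C t) (W t))" .
  qed
  moreover have val: "\<eta> (C t) (W t) \<in> {1, -1}" if t: "t \<in> I" for t
  proof -
    have "(\<eta> (C t) (W t))\<^sup>2 = 1" by (rule frenet_normal[OF frame t])
    then show ?thesis by (simp add: power2_eq_1_iff)
  qed
  moreover have "connected I"
    using curve is_interval_connected unfolding smooth_curve_def by blast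
  moreover have "(\<lambda>t. \<eta> (C t) (W t)) ` I \<subseteq> {1, -1}"
    by (rule image_subsetI) (rule val)
  then have "finite ((\<lambda>t. \<eta> (C t) (W t)) ` I)"
    by (rule finite_subset) simp
  ultimately have "(\<lambda>t. \<eta> (C t) (W t)) constant_on I"
    using continuous_finite_range_constant by blast
  then obtain e where e: "\<And>t. t \<in> I \<Longrightarrow> \<eta> (C t) (W t) = e" by (auto simp: constant_on_def)
  obtain t where "t \<in> I"
    using curve interior_subset[of I] unfolding smooth_curve_def by blast
  then have "e \<in> {1, -1}" using val[of t] e[of t] by simp
  then show ?thesis using e by blast
qed

end

theorem corollary4p1:
  fixes M :: "'a topology"
    and A :: "('a, real^3) chart set"
    and \<phi> :: "'a \<Rightarrow> ('a, real^3) tangent \<Rightarrow> ('a, real^3) tangent"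
    and \<xi> :: "'a \<Rightarrow> ('a, real^3) tangent"
    and \<eta> :: "'a \<Rightarrow> ('a, real^3) tangent \<Rightarrow> real"
    and g :: "'a \<Rightarrow> ('a, real^3) tangent \<Rightarrow> ('a, real^3) tangent \<Rightarrow> real"
    and nabla :: "('a, real^3) connection"
    and I :: "real set"
    and C :: "real \<Rightarrow> 'a"
    and b :: "real \<Rightarrow> real"
  assumes "almost_contact_B_metric M A \<phi> \<xi> \<eta> g"
    and "levi_civita M A g nabla"
    and "sasaki_like M A \<phi> \<xi> \<eta> g nabla"
    and "null_curve M A g I C"
    and "legendre_curve M A \<eta> I C"
    and b_eq: "\<And>t. b t = g (C t) (velocity A I C t) (\<phi> (C t) (velocity A I C t))"
  shows "(\<forall>t\<in>I. covariant_deriv_along A nabla I C (velocity A I C) t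
            = b t *\<^sub>R \<xi> (C t)
              + (vector_derivative b (at t within I) / (2 * b t)) *\<^sub>R velocity A I C t) \<and>
    (\<forall>N W. general_frenet_frame A g I C N W \<longrightarrow>
       (\<exists>\<epsilon>\<in>{1, -1}. \<forall>t\<in>I. frenet_k1 A nabla I C W t = \<epsilon> * b t))"
proof -
  interpret legendre_null_curve M A I C \<phi> \<xi> \<eta> g nabla
    by unfold_locales
      (use assms in \<open>auto simp: almost_contact_B_metric_def null_curve_def\<close>)
  have b: "b = (\<lambda>s. g (C s) (velocity A I C s) (\<phi> (C s) (velocity A I C s)))"
    using b_eq by (rule ext)
  show ?thesis
  proof (intro conjI ballI allI impI)
    fix t assume "t \<in> I"
    then show "covariant_deriv_along A nabla I C (velocity A I C) t
        = b t *\<^sub>R \<xi> (C t) + (vector_derivative b (at t within I) / (2 * b t)) *\<^sub>R velocity A I C t"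
      unfolding b by (rule acceleration_eq)
  next
    fix N W assume "general_frenet_frame A g I C N W"
    then show "\<exists>\<epsilon>\<in>{1, -1}. \<forall>t\<in>I. frenet_k1 A nabla I C W t = \<epsilon> * b t"
      using eta_normal_constant[of N W] frenet_k1_eq[of N W] unfolding b by metis
  qed
qed

end
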